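(* Any polynomial-size data structure for maintaining a longest common substring of two dynamic strings (both undergoing single-letter substitutions), each of length at most $n$, requires $\Omega(\log n/\log\log n)$ time per update operation.
   Context: A longest common substring of two strings is a longest string occurring as a substring of both. The lower bound is for data structures in the cell-probe/word-RAM model with words of $\Theta(\log n)$ bits. *)

theory Defs
  imports Complex_Main
begin

text \<open>A minimal deterministic cell-probe model. Memory is a function from addresses to
  values; a data structure with S cells of w bits reads/writes cell (a mod S) and
  stores values modulo 2^w. Computation is free: a program is an adaptive decision tree
  of probes, ending by returning an answer. Time = number of probes.\<close>

type_synonym mem = "nat \<Rightarrow> nat"

text \<open>Answer of the LCS structure: (i, j, l) meaning that s[i..i+l) = t[j..j+l) is a
  longest common substring.\<close>
type_synonym lcs_ans = "nat \<times> nat \<times> nat"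

datatype prog = Ret lcs_ans | Rd nat "nat \<Rightarrow> prog" | Wr nat nat prog

inductive exec :: "nat \<Rightarrow> nat \<Rightarrow> prog \<Rightarrow> mem \<Rightarrow> lcs_ans \<Rightarrow> mem \<Rightarrow> nat \<Rightarrow> bool"
  for S w :: nat where
  exec_Ret: "exec S w (Ret a) m a m 0"
| exec_Rd: "exec S w (k (m (a mod S) mod 2 ^ w)) m r m' t \<Longrightarrow> exec S w (Rd a k) m r m' (Suc t)"
| exec_Wr: "exec S w p (m(a mod S := v mod 2 ^ w)) r m' t \<Longrightarrow> exec S w (Wr a v p) m r m' (Suc t)"

text \<open>Update operation: (b, i, c) substitutes letter c at position i of the first string
  (b = True) or of the second string (b = False).\<close>
type_synonym upd_op = "bool \<times> nat \<times> nat"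

definition apply_op :: "upd_op \<Rightarrow> nat list \<times> nat list \<Rightarrow> nat list \<times> nat list" where
  "apply_op op st = (case op of (b, i, c) \<Rightarrow>
      if b then ((fst st)[i := c], snd st) else (fst st, (snd st)[i := c]))"

definition valid_op :: "nat \<Rightarrow> upd_op \<Rightarrow> nat list \<times> nat list \<Rightarrow> bool" where
  "valid_op sigma op st = (case op of (b, i, c) \<Rightarrow>
      i < length (if b then fst st else snd st) \<and> c < sigma)"

definition common_sub :: "nat list \<Rightarrow> nat list \<Rightarrow> lcs_ans \<Rightarrow> bool" where
  "common_sub s t a = (case a of (i, j, l) \<Rightarrow>
      i + l \<le> length s \<and> j + l \<le> length t \<and> take l (drop i s) = take l (drop j t))"

definition is_lcs :: "nat list \<Rightarrow> nat list \<Rightarrow> lcs_ans \<Rightarrow> bool" where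
  "is_lcs s t a = (common_sub s t a \<and>
      (\<forall>i' j' l'. common_sub s t (i', j', l') \<longrightarrow> l' \<le> snd (snd a)))"

text \<open>Configurations (current strings, memory) reachable from the initial memory
  built (with free preprocessing) for initial strings s0, t0.\<close>
inductive reach :: "nat \<Rightarrow> nat \<Rightarrow> nat \<Rightarrow> (upd_op \<Rightarrow> prog) \<Rightarrow> nat list \<times> nat list \<Rightarrow> mem
                    \<Rightarrow> nat list \<times> nat list \<Rightarrow> mem \<Rightarrow> bool"
  for sigma S w upd st0 m0 where
  reach_init: "reach sigma S w upd st0 m0 st0 m0"
| reach_step: "reach sigma S w upd st0 m0 st m \<Longrightarrow> valid_op sigma op st \<Longrightarrow>
      exec S w (upd op) m r m' k \<Longrightarrow> reach sigma S w upd st0 m0 (apply_op op st) m'"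

definition good_str :: "nat \<Rightarrow> nat \<Rightarrow> nat list \<Rightarrow> bool" where
  "good_str n sigma s = (length s \<le> n \<and> (\<forall>x\<in>set s. x < sigma))"

definition lcs_ds :: "nat \<Rightarrow> nat \<Rightarrow> nat \<Rightarrow> (nat list \<Rightarrow> nat list \<Rightarrow> mem) \<Rightarrow> (upd_op \<Rightarrow> prog) \<Rightarrow> bool" where
  "lcs_ds n S w init upd = (\<forall>s0 t0 st m op.
      good_str n n s0 \<and> good_str n n t0 \<and> reach n S w upd (s0, t0) (init s0 t0) st m \<and> valid_op n op st
      \<longrightarrow> (\<exists>r m' k. exec S w (upd op) m r m' k \<and> is_lcs (fst (apply_op op st)) (snd (apply_op op st)) r))"

definition update_time_ge :: "nat \<Rightarrow> nat \<Rightarrow> nat \<Rightarrow> (nat list \<Rightarrow> nat list \<Rightarrow> mem) \<Rightarrow> (upd_op \<Rightarrow> prog) \<Rightarrow> real \<Rightarrow> bool" where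
  "update_time_ge n S w init upd x = (\<exists>s0 t0 st m op r m' k.
      good_str n n s0 \<and> good_str n n t0 \<and> reach n S w upd (s0, t0) (init s0 t0) st m \<and> valid_op n op st
      \<and> exec S w (upd op) m r m' k \<and> x \<le> real k)"

end

theory Submission
  imports Defs "HOL-Combinatorics.Permutations" "HOL-Real_Asymp.Real_Asymp"
begin

text \<open>
  Let \<open>N = B ^ k\<close> with \<open>B\<close> polylogarithmic in \<open>n\<close>. At each of \<open>N\<close> times the marks of a complete \<open>B\<close>-ary tree with
  \<open>k\<close> levels are encoded in the first string, level \<open>i\<close> being refreshed every \<open>B ^ i\<close> steps; a leaf \<open>Q\<close> has a marked
  ancestor iff the longest common substring has length \<open>k + 2\<close> after a single substitution in the second string.
  The (time, node) pairs are the edges of a butterfly graph of degree \<open>B\<close>, and the pair (time \<open>\<tau>\<close>, leaf \<open>Q\<close>) is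
  the path from source \<open>\<tau>\<close> to sink \<open>Q\<close>.

  Bob holds an arbitrary set \<open>\<beta>\<close> of edges, used as the history of marks; Alice holds a system of \<open>N\<close> edge-disjoint
  paths, one from each source, given by permutations. They run the \<open>N\<close> queries in parallel. The persistent memory
  is determined by its changes, few per update. Bob first announces every \<open>D\<close>-th change in the order of
  (address, time); in each round Alice names the set of intervals between announced changes hit by her probes,
  which costs \<open>O(N log B)\<close> bits because it is a set, and Bob opens these intervals. So if all operations take \<open>T\<close>
  probes, Alice sends \<open>O(T N log B)\<close> bits and Bob few compared with the number of edges. A transcript is a rectangle,
  and a rectangle of disjoint pairs is small: either Alice's paths in it cover many edges, all of which Bob's sets
  avoid, or her paths are confined to few edges. Since Alice has \<open>\<Omega>(k N log B)\<close> bits of input, \<open>T = \<Omega>(k)\<close>, which is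
  of order \<open>log n / log log n\<close>.
\<close>

section \<open>Counting\<close>

text \<open>Disjoint pairs are counted per transcript class. If the sets \<open>E a\<close> of a class cover more than \<open>z\<close> elements, the class has
  few \<open>b\<close>, as all of them avoid the cover; otherwise it has at most \<open>y\<close> many \<open>a\<close>, and each \<open>b\<close> lies in at most \<open>g\<close> classes.\<close>

lemma disjointness_transcript_count:
  fixes tr :: "'a \<Rightarrow> 'v set \<Rightarrow> 'h" and E :: "'a \<Rightarrow> 'v set"
  assumes fin: "finite A" "finite V"
    and E: "\<And>a. a \<in> A \<Longrightarrow> E a \<subseteq> V" "\<And>a. a \<in> A \<Longrightarrow> card (E a) = e"
    and rect: "\<And>a b a' b'. \<lbrakk>a \<in> A; a' \<in> A; b \<subseteq> V; b' \<subseteq> V; E a \<inter> b = {}; E a' \<inter> b' = {};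
        tr a b = tr a' b'\<rbrakk> \<Longrightarrow> E a \<inter> b' = {}"
    and H: "finite H" "real (card H) \<le> h" "\<And>a b. \<lbrakk>a \<in> A; b \<subseteq> V\<rbrakk> \<Longrightarrow> tr a b \<in> H"
    and g: "\<And>b. b \<subseteq> V \<Longrightarrow> real (card ((\<lambda>a. tr a b) ` A)) \<le> g"
    and y: "\<And>Z. \<lbrakk>Z \<subseteq> V; card Z \<le> z\<rbrakk> \<Longrightarrow> real (card {a \<in> A. E a \<subseteq> Z}) \<le> y"
  shows "real (card A) / 2 ^ e \<le> h * real (card A) / 2 ^ z + g * y"
proof -
  define D where "D = (SIGMA a:A. Pow (V - E a))"
  define Z where "Z x = \<Union> {E a | a. a \<in> A \<and> (\<exists>b \<subseteq> V - E a. tr a b = x)}" for x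
  define H1 where "H1 = {x \<in> H. z < card (Z x)}"
  define H2 where "H2 = {x \<in> H. card (Z x) \<le> z}"
  \<comment> \<open>\<open>C1\<close> and \<open>C2\<close> cover the disjoint pairs
    \<open>D\<close> according to the size of the cover. \<open>C2\<close> lists pairs as
    \<open>(b, a)\<close> because it is counted separately for each \<open>b\<close>.\<close>
  define C1 where "C1 = (\<Union>x\<in>H1. A \<times> Pow (V - Z x))"
  define C2 where "C2 = (SIGMA b:Pow V. \<Union>x\<in>H2 \<inter> (\<lambda>a. tr a b) ` A. {a \<in> A. E a \<subseteq> Z x})"
  have y0: "0 \<le> y" by (rule order_trans[OF of_nat_0_le_iff y[of "{}"]]) auto
  have ZV: "Z x \<subseteq> V" for x unfolding Z_def using E by blast
  have finE: "finite (E a)" if "a \<in> A" for a using E fin that finite_subset by blast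
  have leV: "e \<le> card V" if "a \<in> A" for a using E[OF that] fin card_mono by metis
  have cD: "real (card D) = real (card A) * 2 ^ card V / 2 ^ e"
  proof -
    have "card D = (\<Sum>a\<in>A. card (Pow (V - E a)))" unfolding D_def
      using fin by (intro card_SigmaI) auto
    also have "\<dots> = (\<Sum>a\<in>A. 2 ^ (card V - e))"
      using E fin finE by (intro sum.cong refl) (simp add: card_Pow card_Diff_subset)
    finally have "real (card D) = real (card A) * 2 ^ (card V - e)" by simp
    then show ?thesis using leV by (cases "A = {}") (auto simp: power_diff)
  qed
  have sub: "D \<subseteq> C1 \<union> prod.swap ` C2"
  proof
    fix ab assume "ab \<in> D"
    then obtain a b where ab: "ab = (a, b)" "a \<in> A" "b \<subseteq> V" "E a \<inter> b = {}" unfolding D_def by blast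
    let ?x = "tr a b"
    have x: "?x \<in> H" using H ab by blast
    have EZ: "E a \<subseteq> Z ?x" unfolding Z_def using ab by blast
    \<comment> \<open>If \<open>b\<close> met the cover, it would meet \<open>E a'\<close> for some
      pair \<open>(a', b')\<close> of the same class, against the rectangle property.\<close>
    have "b \<inter> Z ?x = {}"
    proof (rule ccontr)
      assume "b \<inter> Z ?x \<noteq> {}"
      then obtain a' b' where "a' \<in> A" "b' \<subseteq> V - E a'" "tr a' b' = ?x" "E a' \<inter> b \<noteq> {}"
        unfolding Z_def by blast
      then show False using rect[of a' a b' b] ab by blast
    qed
    then have bZ: "b \<in> Pow (V - Z ?x)" using ab by blast
    show "ab \<in> C1 \<union> prod.swap ` C2"
    proof (cases "z < card (Z ?x)")
      case True
      then have "ab \<in> C1" unfolding C1_def H1_def using ab bZ x by blast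
      then show ?thesis by blast
    next
      case False
      then have "(b, a) \<in> C2" unfolding C2_def H2_def using ab x EZ by auto
      then show ?thesis using ab by force
    qed
  qed
  have finC1: "finite C1" unfolding C1_def H1_def using H fin by auto
  have finC2: "finite C2" unfolding C2_def H2_def using fin by (intro finite_SigmaI) auto
  have c1: "real (card C1) \<le> h * (real (card A) * 2 ^ card V / 2 ^ z)"
  proof -
    have "real (card C1) \<le> real (\<Sum>x\<in>H1. card (A \<times> Pow (V - Z x)))"
      unfolding C1_def using H by (intro of_nat_mono card_UN_le) (simp add: H1_def)
    also have "\<dots> = (\<Sum>x\<in>H1. real (card (A \<times> Pow (V - Z x))))" by simp
    also have "\<dots> \<le> (\<Sum>x\<in>H1. real (card A) * 2 ^ card V / 2 ^ z)"
    proof (intro sum_mono)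
      fix x assume x: "x \<in> H1"
      have cZ: "card (Z x) \<le> card V" using ZV fin card_mono by blast
      have "real (card (A \<times> Pow (V - Z x))) = real (card A) * 2 ^ (card V - card (Z x))"
        using ZV fin by (simp add: card_cartesian_product card_Pow card_Diff_subset finite_subset[of "Z x" V])
      also have "\<dots> \<le> real (card A) * 2 ^ (card V - z)"
        using x by (intro mult_left_mono power_increasing) (auto simp: H1_def)
      also have "\<dots> = real (card A) * 2 ^ card V / 2 ^ z"
        using x cZ by (simp add: H1_def power_diff)
      finally show "real (card (A \<times> Pow (V - Z x))) \<le> real (card A) * 2 ^ card V / 2 ^ z" .
    qed
    also have "\<dots> = real (card H1) * (real (card A) * 2 ^ card V / 2 ^ z)" by simp
    also have "\<dots> \<le> h * (real (card A) * 2 ^ card V / 2 ^ z)"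
    proof (intro mult_right_mono)
      have "card H1 \<le> card H" unfolding H1_def using H by (intro card_mono) auto
      then show "real (card H1) \<le> h" using H by linarith
    qed auto
    finally show ?thesis .
  qed
  have c2: "real (card C2) \<le> 2 ^ card V * (g * y)"
  proof -
    have "real (card C2) = (\<Sum>b\<in>Pow V. real (card (\<Union>x\<in>H2 \<inter> (\<lambda>a. tr a b) ` A. {a \<in> A. E a \<subseteq> Z x})))"
      unfolding C2_def using fin by (subst card_SigmaI) auto
    also have "\<dots> \<le> (\<Sum>b\<in>Pow V. g * y)"
    proof (intro sum_mono)
      fix b assume b: "b \<in> Pow V"
      let ?I = "H2 \<inter> (\<lambda>a. tr a b) ` A"
      have "real (card (\<Union>x\<in>?I. {a \<in> A. E a \<subseteq> Z x})) \<le> real (\<Sum>x\<in>?I. card {a \<in> A. E a \<subseteq> Z x})"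
        using fin by (intro of_nat_mono card_UN_le) auto
      also have "\<dots> = (\<Sum>x\<in>?I. real (card {a \<in> A. E a \<subseteq> Z x}))" by simp
      also have "\<dots> \<le> (\<Sum>x\<in>?I. y)"
        using y ZV by (intro sum_mono) (auto simp: H2_def)
      also have "\<dots> = real (card ?I) * y" by simp
      also have "\<dots> \<le> g * y"
      proof (intro mult_right_mono y0)
        have "card ?I \<le> card ((\<lambda>a. tr a b) ` A)" using fin by (intro card_mono) auto
        moreover have "real (card ((\<lambda>a. tr a b) ` A)) \<le> g" using b by (intro g) auto
        ultimately show "real (card ?I) \<le> g" by linarith
      qed
      finally show "real (card (\<Union>x\<in>?I. {a \<in> A. E a \<subseteq> Z x})) \<le> g * y" .
    qed
    also have "\<dots> = 2 ^ card V * (g * y)" using fin by (simp add: card_Pow)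
    finally show ?thesis .
  qed
  have "card D \<le> card (C1 \<union> prod.swap ` C2)" using sub finC1 finC2 by (intro card_mono) auto
  also have "\<dots> \<le> card C1 + card (prod.swap ` C2)" by (rule card_Un_le)
  also have "\<dots> \<le> card C1 + card C2" using finC2 by (simp add: card_image_le)
  finally have "real (card D) \<le> real (card C1) + real (card C2)" by linarith
  with c1 c2 cD have "real (card A) * 2 ^ card V / 2 ^ e
      \<le> h * (real (card A) * 2 ^ card V / 2 ^ z) + 2 ^ card V * (g * y)" by linarith
  also have "\<dots> = 2 ^ card V * (h * real (card A) / 2 ^ z + g * y)" by (simp add: algebra_simps)
  finally have "2 ^ card V * (real (card A) / 2 ^ e) \<le> 2 ^ card V * (h * real (card A) / 2 ^ z + g * y)"
    by (simp add: mult.commute)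
  then show ?thesis by (rule mult_left_le_imp_le) simp
qed

section \<open>Elementary counting estimates\<close>

text \<open>This is the inequality of arithmetic and geometric means:
  \<open>d i / Y \<le> exp (d i / Y - 1)\<close>, and the exponents sum to at most 0.\<close>

lemma prod_card_le_power:
  fixes d :: "'i \<Rightarrow> nat" and Y :: real
  assumes "finite I" "0 < Y" "real (\<Sum>i\<in>I. d i) \<le> Y * card I"
  shows "real (\<Prod>i\<in>I. d i) \<le> Y ^ card I"
proof -
  have "real (d i) \<le> Y * exp (real (d i) / Y - 1)" for i
    using exp_ge_add_one_self[of "real (d i) / Y - 1"] \<open>0 < Y\<close> by (simp add: field_simps)
  then have "(\<Prod>i\<in>I. real (d i)) \<le> (\<Prod>i\<in>I. Y * exp (real (d i) / Y - 1))"
    by (intro prod_mono) simp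
  also have "\<dots> = Y ^ card I * exp (\<Sum>i\<in>I. real (d i) / Y - 1)"
    using \<open>finite I\<close> by (simp add: prod.distrib exp_sum)
  also have "(\<Sum>i\<in>I. real (d i) / Y - 1) = (\<Sum>i\<in>I. real (d i)) / Y - card I"
    by (simp add: sum_subtractf sum_divide_distrib)
  also have "Y ^ card I * exp \<dots> \<le> Y ^ card I * 1"
    using assms by (intro mult_left_mono) (auto simp: field_simps)
  finally show ?thesis by simp
qed

text \<open>The binomial theorem in the form of a sum over subsets.\<close>

lemma sum_power_card_Pow:
  fixes x :: real
  assumes "finite P"
  shows "(\<Sum>J\<in>Pow P. x ^ card J) = (1 + x) ^ card P"
  using assms
proof (induction P rule: finite_induct)
  case (insert a P)
  have "(\<Sum>J\<in>Pow (insert a P). x ^ card J) = (\<Sum>J\<in>Pow P. x ^ card J) + (\<Sum>J\<in>insert a ` Pow P. x ^ card J)"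
    unfolding Pow_insert using insert by (intro sum.union_disjoint) auto
  also have "(\<Sum>J\<in>insert a ` Pow P. x ^ card J) = (\<Sum>J\<in>Pow P. x ^ card (insert a J))"
    using insert by (subst sum.reindex) (auto intro!: inj_onI simp: insert_ident)
  also have "\<dots> = (\<Sum>J\<in>Pow P. x * x ^ card J)"
    using insert by (intro sum.cong refl) (auto simp: card_insert_if finite_subset)
  finally show ?case using insert by (simp add: sum_distrib_left[symmetric] algebra_simps)
qed simp

text \<open>Every set counted has weight \<open>r ^ N * (1 / r) ^ card J \<ge> 1\<close>, and over
  all subsets the weights sum to \<open>r ^ N * (1 + 1 / r) ^ card P\<close>, at most
  \<open>(e * r) ^ N\<close>. Naming such a set therefore costs only \<open>O(N log r)\<close> bits
  when \<open>r\<close> is large.\<close>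

lemma card_small_subsets_le:
  fixes r :: real
  assumes "finite P" "1 \<le> r" "real (card P) \<le> r * real N"
  shows "real (card {J. J \<subseteq> P \<and> card J \<le> N}) \<le> (3 * r) ^ N"
proof -
  have "real (card {J. J \<subseteq> P \<and> card J \<le> N}) = (\<Sum>J | J \<subseteq> P \<and> card J \<le> N. 1)" by simp
  also have "\<dots> \<le> (\<Sum>J | J \<subseteq> P \<and> card J \<le> N. r ^ N * (1 / r) ^ card J)"
    using assms by (intro sum_mono) (auto simp: power_divide power_increasing)
  also have "\<dots> \<le> (\<Sum>J\<in>Pow P. r ^ N * (1 / r) ^ card J)"
    using assms by (intro sum_mono2) auto
  also have "\<dots> = r ^ N * (1 + 1 / r) ^ card P"
    using sum_power_card_Pow[OF assms(1), of "1 / r"] by (simp add: sum_distrib_left[symmetric])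
  also have "(1 + 1 / r) ^ card P \<le> exp (1 / r) ^ card P"
    using assms by (intro power_mono exp_ge_add_one_self) auto
  also have "exp (1 / r) ^ card P = exp (real (card P) / r)"
    by (simp add: exp_of_nat_mult[symmetric])
  also have "\<dots> \<le> exp (real N)" using assms by (simp add: field_simps)
  also have "\<dots> = exp 1 ^ N" by (simp add: exp_of_nat_mult[symmetric])
  also have "\<dots> \<le> 3 ^ N" using exp_le by (intro power_mono) auto
  finally show ?thesis using assms by (simp add: power_mult_distrib mult.commute)
qed

text \<open>A set with at most \<open>m\<close> elements is the content of a list of length
  \<open>m\<close> padded with \<open>None\<close>. This crude count serves for Bob's part of the
  communication.\<close>

lemma card_bounded_subsets_le:
  assumes "finite X"
  shows "card {J. J \<subseteq> X \<and> card J \<le> m} \<le> (card X + 1) ^ m"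
proof -
  have "{J. J \<subseteq> X \<and> card J \<le> m} \<subseteq>
      (\<lambda>xs. {x. Some x \<in> set xs}) ` {xs. set xs \<subseteq> insert None (Some ` X) \<and> length xs = m}"
  proof
    fix J assume J: "J \<in> {J. J \<subseteq> X \<and> card J \<le> m}"
    then obtain ys where ys: "set ys = J" "distinct ys"
      using assms finite_distinct_list finite_subset by blast
    then have "length ys \<le> m" using J distinct_card by fastforce
    then show "J \<in> (\<lambda>xs. {x. Some x \<in> set xs}) ` {xs. set xs \<subseteq> insert None (Some ` X) \<and> length xs = m}"
      using J ys by (intro image_eqI[of _ _ "map Some ys @ replicate (m - length ys) None"]) auto
  qed
  moreover have fin: "finite {xs. set xs \<subseteq> insert None (Some ` X) \<and> length xs = m}"
    using assms by (intro finite_lists_length_eq) auto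
  ultimately have "card {J. J \<subseteq> X \<and> card J \<le> m} \<le> card {xs. set xs \<subseteq> insert None (Some ` X) \<and> length xs = m}"
    by (rule surj_card_le[rotated])
  also have "\<dots> = (card X + 1) ^ m"
    using assms by (subst card_lists_length_eq) (auto simp: card_image)
  finally show "card {J. J \<subseteq> X \<and> card J \<le> m} \<le> (card X + 1) ^ m" .
qed

text \<open>A weak form of Stirling's formula; the induction step rests on
  \<open>(1 + 1 / n) ^ n \<le> e \<le> 3\<close>.\<close>

lemma power_self_le_fact: "real n ^ n \<le> 3 ^ n * fact n"
proof (induction n)
  case (Suc n)
  have *: "real (Suc n) ^ n \<le> 3 * real n ^ n"
  proof (cases "n = 0")
    case False
    have "(1 + 1 / real n) ^ n \<le> exp (1 / real n) ^ n"
      by (intro power_mono exp_ge_add_one_self) auto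
    also have "\<dots> = exp 1" using False by (simp add: exp_of_nat_mult[symmetric])
    also have "\<dots> \<le> 3" by (rule exp_le)
    finally have "real n ^ n * (1 + 1 / real n) ^ n \<le> real n ^ n * 3" by (intro mult_left_mono) auto
    moreover have "real n ^ n * (1 + 1 / real n) ^ n = real (Suc n) ^ n"
      using False by (simp add: power_mult_distrib[symmetric] field_simps)
    ultimately show ?thesis by simp
  qed simp
  have "real (Suc n) ^ Suc n = real (Suc n) * real (Suc n) ^ n" by simp
  also have "\<dots> \<le> real (Suc n) * (3 * (3 ^ n * fact n))"
    using * Suc.IH by (intro mult_left_mono) auto
  finally show ?case by (simp add: algebra_simps)
qed simp

section \<open>Butterfly routings\<close>

text \<open>One layer of a permutation routing on a butterfly with \<open>N = B * M\<close> vertices per layer: the lowest base-\<open>B\<close> digit of a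
  vertex is dropped and a new highest digit is chosen.\<close>

definition shifts :: "nat \<Rightarrow> nat \<Rightarrow> (nat \<Rightarrow> nat) set" where
  "shifts B M = {\<sigma> \<in> {..<B * M} \<rightarrow>\<^sub>E {..<B * M}. inj_on \<sigma> {..<B * M} \<and> (\<forall>x<B * M. \<sigma> x mod M = x div B)}"

definition edges :: "nat \<Rightarrow> nat \<Rightarrow> nat \<Rightarrow> (nat \<times> nat \<times> nat) set" where
  "edges k B M = {(i, x, y). i < k \<and> x < B * M \<and> y < B * M \<and> y mod M = x div B}"

definition used :: "nat \<Rightarrow> nat \<Rightarrow> (nat \<Rightarrow> nat \<Rightarrow> nat) \<Rightarrow> (nat \<times> nat \<times> nat) set" where
  "used k N \<alpha> = (\<lambda>(i, x). (i, x, \<alpha> i x)) ` ({..<k} \<times> {..<N})"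

lemma finite_shifts: "finite (shifts B M)"
  unfolding shifts_def by (rule finite_subset[of _ "{..<B * M} \<rightarrow>\<^sub>E {..<B * M}"]) (auto intro: finite_PiE)

text \<open>The \<open>B\<close> vertices with a common \<open>x div B\<close> go to the
  \<open>B\<close> vertices with that residue modulo \<open>M\<close>, in any order, so each of the
  \<open>M\<close> groups contributes a factor \<open>fact B\<close>.\<close>

lemma card_shifts_ge:
  assumes "0 < B" "0 < M"
  shows "fact B ^ M \<le> card (shifts B M)"
proof -
  \<comment> \<open>\<open>p\<close> assigns a permutation to each group; its value at the dropped
    digit becomes the new highest digit.\<close>
  define \<Phi> where "\<Phi> p = restrict (\<lambda>x. p (x div B) (x mod B) * M + x div B) {..<B * M}" for p :: "nat \<Rightarrow> nat \<Rightarrow> nat"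
  let ?P = "{..<M} \<rightarrow>\<^sub>E {p. p permutes {..<B}}"
  have lt: "x div B < M" "x mod B < B" if "x < B * M" for x
    using that assms by (auto simp: less_mult_imp_div_less mult.commute)
  have val: "\<Phi> p x mod M = x div B" "\<Phi> p x div M = p (x div B) (x mod B)" if "x < B * M" for p x
    using that assms lt[OF that] by (auto simp: \<Phi>_def)
  have "inj_on \<Phi> ?P"
  proof (rule inj_onI)
    fix p p' assume p: "p \<in> ?P" "p' \<in> ?P" and eq: "\<Phi> p = \<Phi> p'"
    show "p = p'"
    proof (rule PiE_ext[OF p])
      fix g assume g: "g \<in> {..<M}"
      have perm: "p g permutes {..<B}" "p' g permutes {..<B}" using p g by (auto dest!: PiE_mem)
      show "p g = p' g"
      proof
        fix d show "p g d = p' g d"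
        proof (cases "d < B")
          case True
          have "g * B + d < B * M"
          proof -
            have "g * B + d < (g + 1) * B" using True by simp
            also have "\<dots> \<le> M * B" using g by (intro mult_right_mono) auto
            finally show ?thesis by (simp add: mult.commute)
          qed
          from val(2)[OF this, of p] val(2)[OF this, of p'] eq show ?thesis using True by simp
        qed (use perm in \<open>auto simp: permutes_def\<close>)
      qed
    qed
  qed
  moreover have "\<Phi> ` ?P \<subseteq> shifts B M"
  proof
    fix \<sigma> assume "\<sigma> \<in> \<Phi> ` ?P"
    then obtain p where p: "p \<in> ?P" "\<sigma> = \<Phi> p" by blast
    have perm: "p g permutes {..<B}" if "g < M" for g using p that by (auto dest!: PiE_mem)
    have bnd: "\<Phi> p x < B * M" if x: "x < B * M" for x
    proof -
      have "p (x div B) (x mod B) < B"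
        using permutes_in_image[OF perm[OF lt(1)[OF x]]] lt(2)[OF x] by auto
      then have "\<Phi> p x < (p (x div B) (x mod B) + 1) * M"
        using x lt(1)[OF x] by (simp add: \<Phi>_def)
      also have "\<dots> \<le> B * M" using \<open>p _ _ < B\<close> by (intro mult_right_mono) auto
      finally show ?thesis .
    qed
    have inj: "inj_on (\<Phi> p) {..<B * M}"
    proof (rule inj_onI)
      fix x x' assume x: "x \<in> {..<B * M}" "x' \<in> {..<B * M}" and eq: "\<Phi> p x = \<Phi> p x'"
      have g: "x div B = x' div B" using val(1)[of x p] val(1)[of x' p] x eq by auto
      have "p (x div B) (x mod B) = p (x div B) (x' mod B)"
        using val(2)[of x p] val(2)[of x' p] x eq g by auto
      then have "x mod B = x' mod B"
        using permutes_inj[OF perm[OF lt(1)[of x]]] x by (auto dest: injD)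
      with g show "x = x'" by (metis div_mult_mod_eq)
    qed
    show "\<sigma> \<in> shifts B M"
      unfolding shifts_def p using bnd inj val(1)[of _ p] by (simp add: PiE_iff) (simp add: \<Phi>_def)
  qed
  ultimately have "card ?P \<le> card (shifts B M)"
    by (intro card_inj_on_le finite_shifts)
  moreover have "card ?P = fact B ^ M" by (simp add: card_PiE card_permutations)
  ultimately show ?thesis by simp
qed

text \<open>By Stirling's bound every vertex of every layer contributes a factor
  \<open>B / 3\<close>. This measures Alice's input.\<close>

lemma card_shifts_family_ge:
  assumes "0 < B" "0 < M"
  shows "(real B / 3) ^ (k * (B * M)) \<le> real (card ({..<k} \<rightarrow>\<^sub>E shifts B M))"
proof -
  have "(real B / 3) ^ (B * M) = (real B ^ B / 3 ^ B) ^ M" by (simp add: power_mult power_divide)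
  also have "\<dots> \<le> fact B ^ M"
    using power_self_le_fact[of B] by (intro power_mono) (auto simp: field_simps)
  also have "\<dots> \<le> real (card (shifts B M))"
    using card_shifts_ge[OF assms] of_nat_le_iff[of "fact B ^ M" "card (shifts B M)", where 'a = real] by simp
  finally have "((real B / 3) ^ (B * M)) ^ k \<le> real (card (shifts B M)) ^ k" by (intro power_mono) auto
  then show ?thesis by (simp add: card_PiE power_mult[symmetric] mult.commute)
qed

text \<open>An edge is fixed by its layer, its source and the new digit
  \<open>y div M\<close>.\<close>

lemma finite_edges: "finite (edges k B M)"
  and card_edges_le: "card (edges k B M) \<le> k * (B * M) * B"
proof -
  let ?f = "\<lambda>(i, x, y). (i, x, y div M)"
  have inj: "inj_on ?f (edges k B M)"
    by (auto simp: inj_on_def edges_def) (metis div_mult_mod_eq)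
  have img: "?f ` edges k B M \<subseteq> {..<k} \<times> {..<B * M} \<times> {..<B}"
    by (auto simp: edges_def less_mult_imp_div_less)
  show "finite (edges k B M)" using inj img by (rule inj_on_finite) auto
  show "card (edges k B M) \<le> k * (B * M) * B"
    using card_inj_on_le[OF inj img] by (simp add: card_cartesian_product mult.assoc)
qed

lemma used_subset_edges:
  assumes "\<alpha> \<in> {..<k} \<rightarrow>\<^sub>E shifts B M"
  shows "used k (B * M) \<alpha> \<subseteq> edges k B M"
proof -
  have "\<alpha> i x < B * M \<and> \<alpha> i x mod M = x div B" if "i < k" "x < B * M" for i x
  proof -
    have "\<alpha> i \<in> shifts B M" using assms that by auto
    then show ?thesis using that unfolding shifts_def by (auto dest!: PiE_mem)
  qed
  then show ?thesis by (auto simp: used_def edges_def)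
qed

lemma card_used: "card (used k N \<alpha>) = k * N"
  unfolding used_def by (subst card_image) (auto simp: inj_on_def card_cartesian_product)

text \<open>A routing inside \<open>Z\<close> picks at each \<open>(i, x)\<close> one of the edges
  of \<open>Z\<close> leaving it. These out-degrees are at most \<open>Y\<close> on average, which
  bounds their product.\<close>

lemma card_used_within_le:
  assumes Z: "finite Z" "card Z \<le> k * (B * M) * Y" and "0 < Y"
  shows "real (card {\<alpha> \<in> {..<k} \<rightarrow>\<^sub>E shifts B M. used k (B * M) \<alpha> \<subseteq> Z}) \<le> real Y ^ (k * (B * M))"
proof -
  let ?S = "{\<alpha> \<in> {..<k} \<rightarrow>\<^sub>E shifts B M. used k (B * M) \<alpha> \<subseteq> Z}"
  let ?I = "{..<k} \<times> {..<B * M}"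
  let ?d = "\<lambda>(i, x). {y. (i, x, y) \<in> Z}"
  let ?f = "\<lambda>\<alpha>. restrict (\<lambda>(i, x). \<alpha> i x) ?I"
  have find: "finite (?d p)" for p
  proof (rule finite_subset)
    show "?d p \<subseteq> (snd \<circ> snd) ` Z" by (cases p) force
  qed (use Z in simp)
  have inj: "inj_on ?f ?S"
  proof (rule inj_onI)
    fix \<alpha> \<alpha>' assume S: "\<alpha> \<in> ?S" "\<alpha>' \<in> ?S" and eq: "?f \<alpha> = ?f \<alpha>'"
    have P: "\<alpha> \<in> {..<k} \<rightarrow>\<^sub>E shifts B M" "\<alpha>' \<in> {..<k} \<rightarrow>\<^sub>E shifts B M" using S by auto
    show "\<alpha> = \<alpha>'"
    proof (rule PiE_ext[OF P])
      fix i assume i: "i \<in> {..<k}"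
      have sh: "\<alpha> i \<in> {..<B * M} \<rightarrow>\<^sub>E {..<B * M}" "\<alpha>' i \<in> {..<B * M} \<rightarrow>\<^sub>E {..<B * M}"
        using PiE_mem[OF P(1) i] PiE_mem[OF P(2) i] unfolding shifts_def by auto
      show "\<alpha> i = \<alpha>' i"
      proof (rule PiE_ext[OF sh])
        fix x assume "x \<in> {..<B * M}"
        then show "\<alpha> i x = \<alpha>' i x" using fun_cong[OF eq, of "(i, x)"] i by simp
      qed
    qed
  qed
  have img: "?f ` ?S \<subseteq> PiE ?I ?d" by (auto simp: used_def)
  have "card ?S \<le> card (PiE ?I ?d)"
    by (rule card_inj_on_le[OF inj img]) (intro finite_PiE, auto simp: find[of "(_, _)", simplified])
  also have "\<dots> = (\<Prod>p\<in>?I. card (?d p))" by (subst card_PiE) auto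
  finally have "real (card ?S) \<le> real (\<Prod>p\<in>?I. card (?d p))" by linarith
  also have "\<dots> \<le> real Y ^ card ?I"
  proof (rule prod_card_le_power)
    have "(\<Sum>p\<in>?I. card (?d p)) = card (SIGMA p:?I. ?d p)"
      using find by (subst card_SigmaI) auto
    also have "\<dots> \<le> card Z"
    proof (rule card_inj_on_le[OF _ _ Z(1)])
      show "inj_on (\<lambda>((i, x), y). (i, x, y)) (SIGMA p:?I. ?d p)" by (auto simp: inj_on_def)
    qed auto
    finally have "(\<Sum>p\<in>?I. card (?d p)) \<le> Y * card ?I"
      using Z(2) by (simp add: card_cartesian_product mult.commute)
    then have "real (\<Sum>p\<in>?I. card (?d p)) \<le> real (Y * card ?I)" by (rule of_nat_mono)
    then show "real (\<Sum>p\<in>?I. card (?d p)) \<le> real Y * real (card ?I)" unfolding of_nat_mult .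
  qed (use \<open>0 < Y\<close> in auto)
  finally show ?thesis by (simp add: card_cartesian_product)
qed

section \<open>Digits along the paths of a routing\<close>

fun path :: "(nat \<Rightarrow> nat \<Rightarrow> nat) \<Rightarrow> nat \<Rightarrow> nat \<Rightarrow> nat" where
  "path \<alpha> 0 \<tau> = \<tau>"
| "path \<alpha> (Suc i) \<tau> = \<alpha> i (path \<alpha> i \<tau>)"

lemma path_bij:
  assumes "\<alpha> \<in> {..<k} \<rightarrow>\<^sub>E shifts B M" "i \<le> k"
  shows "bij_betw (path \<alpha> i) {..<B * M} {..<B * M}"
  using assms(2)
proof (induction i)
  case (Suc i)
  have s: "\<alpha> i \<in> shifts B M" using PiE_mem[OF assms(1)] Suc.prems by simp
  have "bij_betw (\<alpha> i) {..<B * M} {..<B * M}"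
  proof -
    have "inj_on (\<alpha> i) {..<B * M}" "\<alpha> i ` {..<B * M} \<subseteq> {..<B * M}" using s by (auto simp: shifts_def)
    then show ?thesis by (simp add: bij_betw_def endo_inj_surj)
  qed
  then have "bij_betw (\<alpha> i \<circ> path \<alpha> i) {..<B * M} {..<B * M}"
    using Suc by (intro bij_betw_trans[of _ _ "{..<B * M}"]) auto
  then show ?case by (simp add: comp_def)
qed (simp add: bij_betw_def inj_on_def)

text \<open>Every step drops the lowest digit and adds a highest one, so the digits of the source
  that remain are its high ones, moved to the bottom.\<close>

lemma path_mod:
  assumes \<alpha>: "\<alpha> \<in> {..<k} \<rightarrow>\<^sub>E shifts B (B ^ (k - 1))" and "0 < B" "\<tau> < B ^ k" "i \<le> k"
  shows "path \<alpha> i \<tau> mod B ^ (k - i) = \<tau> div B ^ i"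
  using assms(4)
proof (induction i)
  case (Suc i)
  have N: "B * B ^ (k - 1) = B ^ k" using Suc by (cases k) auto
  let ?x = "path \<alpha> i \<tau>"
  have x: "?x < B ^ k"
    using bij_betwE[OF path_bij[OF \<alpha>, of i]] Suc \<open>\<tau> < B ^ k\<close> N by auto
  have s: "\<alpha> i ?x mod B ^ (k - 1) = ?x div B"
    using \<alpha> Suc x N by (auto simp: shifts_def dest!: PiE_mem[of _ _ _ i])
  have "\<alpha> i ?x mod B ^ (k - Suc i) = (\<alpha> i ?x mod B ^ (k - 1)) mod B ^ (k - Suc i)"
    by (simp add: mod_mod_cancel le_imp_power_dvd)
  also have "\<dots> = ?x mod B ^ (k - i) div B"
  proof -
    have "B ^ (k - i) = B * B ^ (k - Suc i)" using Suc by (simp add: Suc_diff_Suc flip: power_Suc)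
    then show ?thesis unfolding s using \<open>0 < B\<close> by (simp add: mod_mult2_eq)
  qed
  also have "\<dots> = \<tau> div B ^ Suc i" using Suc by (simp add: div_mult2_eq[symmetric] mult.commute)
  finally show ?case by simp
qed (use \<open>\<tau> < B ^ k\<close> in simp)

text \<open>A digit chosen at the top is afterwards only shifted down, so the first \<open>i\<close>
  chosen digits end up as the low digits of the sink.\<close>

lemma path_div:
  assumes \<alpha>: "\<alpha> \<in> {..<k} \<rightarrow>\<^sub>E shifts B (B ^ (k - 1))" and "0 < B" "\<tau> < B ^ k" "i \<le> k"
  shows "path \<alpha> i \<tau> div B ^ (k - i) = path \<alpha> k \<tau> mod B ^ i"
proof -
  have N: "0 < k \<Longrightarrow> B * B ^ (k - 1) = B ^ k" by (cases k) auto
  have lt: "path \<alpha> j \<tau> < B ^ k" if "j \<le> k" for j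
    using bij_betwE[OF path_bij[OF \<alpha>, of j]] that \<open>\<tau> < B ^ k\<close> N by (cases "k = 0") auto
  \<comment> \<open>Removing the newest digit leaves the digits chosen earlier, one place
    lower.\<close>
  have step: "path \<alpha> (Suc j) \<tau> div B ^ (k - Suc j) mod B ^ j = path \<alpha> j \<tau> div B ^ (k - j)" if j: "j < k" for j
  proof -
    let ?x = "path \<alpha> j \<tau>"
    have x: "?x < B ^ k" using lt j by simp
    have "\<alpha> j ?x mod B ^ (k - 1) = ?x div B"
      using \<alpha> j x N by (auto simp: shifts_def dest!: PiE_mem[of _ _ _ j])
    moreover have "B ^ (k - 1) = B ^ (k - Suc j) * B ^ j" using j by (simp flip: power_add)
    ultimately have "(\<alpha> j ?x) mod (B ^ (k - Suc j) * B ^ j) div B ^ (k - Suc j) = ?x div B div B ^ (k - Suc j)"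
      by simp
    then have "\<alpha> j ?x div B ^ (k - Suc j) mod B ^ j = ?x div B div B ^ (k - Suc j)"
      using \<open>0 < B\<close> by (simp add: mod_mult2_eq)
    also have "\<dots> = ?x div B ^ (k - j)"
      using j by (simp add: div_mult2_eq[symmetric] Suc_diff_Suc flip: power_Suc)
    finally show ?thesis by simp
  qed
  \<comment> \<open>Generalised to layer \<open>i + d\<close> for the induction;
    \<open>d = k - i\<close> reaches the sink.\<close>
  have "path \<alpha> (i + d) \<tau> div B ^ (k - (i + d)) mod B ^ i = path \<alpha> i \<tau> div B ^ (k - i)" if "i + d \<le> k" for d
    using that
  proof (induction d)
    case 0
    have "path \<alpha> i \<tau> < B ^ (k - i) * B ^ i" using lt[of i] 0 by (simp flip: power_add)
    then show ?case by (simp add: less_mult_imp_div_less mult.commute)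
  next
    case (Suc d)
    have "path \<alpha> (Suc (i + d)) \<tau> div B ^ (k - Suc (i + d)) mod B ^ i
      = (path \<alpha> (Suc (i + d)) \<tau> div B ^ (k - Suc (i + d)) mod B ^ (i + d)) mod B ^ i"
      by (simp add: mod_mod_cancel le_imp_power_dvd)
    then show ?case using step[of "i + d"] Suc by simp
  qed
  from this[of "k - i"] \<open>i \<le> k\<close> show ?thesis by simp
qed

section \<open>Communication transcripts of parallel probing\<close>

text \<open>The intervals between landmarks are the units that Bob opens. Adding 0 gives every
  number a last landmark at or below it.\<close>

definition landmarks :: "nat \<Rightarrow> nat set \<Rightarrow> nat set" where
  "landmarks D L = insert 0 {y \<in> L. D dvd card {z \<in> L. z < y}}"

definition bucket :: "nat set \<Rightarrow> nat \<Rightarrow> nat" where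
  "bucket P x = Max {p \<in> P. p \<le> x}"

lemma zero_in_landmarks: "0 \<in> landmarks D L"
  and landmarks_subset: "landmarks D L \<subseteq> insert 0 L"
  by (auto simp: landmarks_def)

lemma finite_landmarks: "finite L \<Longrightarrow> finite (landmarks D L)"
  by (simp add: landmarks_def)

lemma bucket_in:
  assumes "0 \<in> P" shows "bucket P x \<in> P" "bucket P x \<le> x"
proof -
  have "Max {p \<in> P. p \<le> x} \<in> {p \<in> P. p \<le> x}" using assms by (intro Max_in) auto
  then show "bucket P x \<in> P" "bucket P x \<le> x" by (auto simp: bucket_def)
qed

lemma le_bucket: "p \<in> P \<Longrightarrow> p \<le> x \<Longrightarrow> p \<le> bucket P x"
  unfolding bucket_def by (intro Max_ge) auto

lemma bucket_eq:
  assumes "0 \<in> P" "bucket P x \<le> y" "y \<le> x"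
  shows "bucket P y = bucket P x"
proof (rule antisym)
  show "bucket P y \<le> bucket P x" using bucket_in[OF assms(1), of y] assms by (intro le_bucket) auto
  show "bucket P x \<le> bucket P y" using bucket_in[OF assms(1), of x] assms by (intro le_bucket) auto
qed

lemma rank_strict_mono:
  fixes L :: "nat set"
  assumes "finite L" "y \<in> L" "y < y'"
  shows "card {z \<in> L. z < y} < card {z \<in> L. z < y'}"
  using assms by (intro psubset_card_mono) auto

lemma rank_bij:
  fixes L :: "nat set"
  assumes "finite L"
  shows "bij_betw (\<lambda>y. card {z \<in> L. z < y}) L {..<card L}"
proof -
  have inj: "inj_on (\<lambda>y. card {z \<in> L. z < y}) L"
  proof (rule inj_onI)
    fix y y' assume "y \<in> L" "y' \<in> L" "card {z \<in> L. z < y} = card {z \<in> L. z < y'}"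
    then show "y = y'"
      using rank_strict_mono[OF assms, of y y'] rank_strict_mono[OF assms, of y' y] by linarith
  qed
  moreover have "(\<lambda>y. card {z \<in> L. z < y}) ` L \<subseteq> {..<card L}"
    using assms by (auto intro!: psubset_card_mono)
  ultimately show ?thesis
    by (simp add: bij_betw_def card_image card_subset_eq)
qed

text \<open>Among the elements of rank divisible by \<open>D\<close> the quotient by
  \<open>D\<close> is injective. The summand \<open>2 * D\<close> pays for the quotient 0 and for
  the added landmark 0.\<close>

lemma card_landmarks:
  assumes "finite L" "0 < D"
  shows "D * card (landmarks D L) \<le> card L + 2 * D"
proof -
  let ?r = "\<lambda>y. card {z \<in> L. z < y}"
  let ?P = "{y \<in> L. D dvd ?r y}"
  have inj: "inj_on (\<lambda>y. ?r y div D) ?P"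
  proof (rule inj_onI)
    fix y y' assume y: "y \<in> ?P" "y' \<in> ?P" "?r y div D = ?r y' div D"
    then have "?r y = ?r y'" by (metis (no_types, lifting) dvd_div_mult_self mem_Collect_eq)
    then show "y = y'" using y rank_bij[OF assms(1)] by (auto simp: bij_betw_def dest: inj_onD)
  qed
  have "card ?P \<le> card {..card L div D}"
  proof (rule card_inj_on_le[OF inj])
    show "(\<lambda>y. ?r y div D) ` ?P \<subseteq> {..card L div D}"
      using assms by (auto intro!: div_le_mono card_mono)
  qed simp
  then have "card (landmarks D L) \<le> card L div D + 2"
    unfolding landmarks_def using assms by (simp add: card_insert_if)
  then have "D * card (landmarks D L) \<le> D * (card L div D + 2)" by (rule mult_le_mono2)
  also have "\<dots> \<le> card L + 2 * D" by (simp add: algebra_simps)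
  finally show ?thesis .
qed

text \<open>The quotient of the rank by \<open>D\<close> is constant on a bucket, as otherwise an
  element of rank divisible by \<open>D\<close> would be a landmark separating two of its
  members.\<close>

lemma card_bucket_le:
  assumes "finite L" "0 < D"
  shows "card {y \<in> L. bucket (landmarks D L) y = p} \<le> D"
proof (cases "{y \<in> L. bucket (landmarks D L) y = p} = {}")
  case True
  then show ?thesis by (metis card.empty zero_le)
next
  case False
  let ?r = "\<lambda>y. card {z \<in> L. z < y}" and ?P = "landmarks D L"
  let ?S = "{y \<in> L. bucket ?P y = p}"
  have same: "\<not> ?r y div D < ?r y' div D" if y: "y \<in> ?S" "y' \<in> ?S" for y y'
  proof
    assume less: "?r y div D < ?r y' div D"
    \<comment> \<open>The first rank with the larger quotient; it is below \<open>card L\<close>, so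
      some \<open>q\<close> in \<open>L\<close> has it.\<close>
    let ?j = "D * (?r y' div D)"
    have "?j \<le> ?r y'" by simp
    moreover have r': "?r y' < card L" using rank_bij[OF assms(1)] y by (auto simp: bij_betw_def)
    ultimately have "?j \<in> {..<card L}" by (metis le_less_trans lessThan_iff)
    then have "?j \<in> ?r ` L" using rank_bij[OF assms(1)] by (simp add: bij_betw_def)
    then obtain q where q: "q \<in> L" "?r q = ?j" by auto
    have "?r y < ?j" using div_less_iff_less_mult[OF assms(2), of "?r y" "?r y' div D"] less by (simp only: mult.commute)
    then have "?r y < ?r q" "?r q \<le> ?r y'" using q(2) by simp_all
    then have "y < q"
      using rank_strict_mono[OF assms(1) q(1), of y] by (cases y q rule: linorder_cases) auto
    moreover have "q \<le> y'"
    proof (rule ccontr)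
      assume "\<not> q \<le> y'"
      then have "?r y' < ?r q" using y by (intro rank_strict_mono[OF assms(1)]) auto
      with \<open>?r q \<le> ?r y'\<close> show False by simp
    qed
    moreover have "q \<in> ?P" using q by (simp add: landmarks_def)
    ultimately have "q \<le> p" "p \<le> y" using y le_bucket[of q ?P y'] bucket_in(2)[OF zero_in_landmarks, of D L y] by auto
    with \<open>y < q\<close> show False by simp
  qed
  obtain y0 where y0: "y0 \<in> ?S" using False by blast
  let ?j = "?r y0 div D"
  have "?r ` ?S \<subseteq> {D * ?j..<D * ?j + D}"
  proof
    fix r assume "r \<in> ?r ` ?S"
    then obtain y where y: "y \<in> ?S" "r = ?r y" by auto
    then have "r div D = ?j" using same[OF y(1) y0] same[OF y0 y(1)] by simp
    then show "r \<in> {D * ?j..<D * ?j + D}"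
      using mod_less_divisor[OF assms(2), of r] mult_div_mod_eq[of D r] by (simp del: mod_less_divisor)
  qed
  moreover have "inj_on ?r ?S" using rank_bij[OF assms(1)] by (auto simp: bij_betw_def inj_on_def)
  ultimately show ?thesis using card_inj_on_le[of ?r ?S "{D * ?j..<D * ?j + D}"] by simp
qed

section \<open>The communication protocol\<close>

text \<open>Abstract form of queries on a persistent memory: a key combines address and time,
  \<open>L \<beta>\<close> collects the keys at which the memory changes, \<open>val \<beta>\<close>
  is the content. By \<open>determined\<close> a content follows from the changes since a common
  starting point; this may be key 0, since the initial memory will be the same for all
  \<beta>.\<close>

locale probe_scheme =
  fixes N T K W D :: nat and Bs :: "'b set"
    and L :: "'b \<Rightarrow> nat set" and val :: "'b \<Rightarrow> nat \<Rightarrow> nat"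
    and key :: "nat \<Rightarrow> 's \<Rightarrow> nat" and step :: "nat \<Rightarrow> 's \<Rightarrow> 's" and start :: "'a \<Rightarrow> nat \<Rightarrow> 's"
  assumes D_pos: "0 < D" and K_pos: "0 < K"
    and key_less: "\<tau> < N \<Longrightarrow> key \<tau> s < K"
    and L_subset: "\<beta> \<in> Bs \<Longrightarrow> L \<beta> \<subseteq> {..<K}"
    and val_less: "\<beta> \<in> Bs \<Longrightarrow> y \<in> L \<beta> \<Longrightarrow> val \<beta> y < W"
    and determined: "\<lbrakk>\<beta> \<in> Bs; \<beta>' \<in> Bs; x < K; p \<le> x; p = 0 \<or> p \<in> L \<beta> \<and> p \<in> L \<beta>';
        \<And>y. p \<le> y \<Longrightarrow> y \<le> x \<Longrightarrow> y \<in> L \<beta> \<longleftrightarrow> y \<in> L \<beta>';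
        \<And>y. p \<le> y \<Longrightarrow> y \<le> x \<Longrightarrow> y \<in> L \<beta> \<Longrightarrow> val \<beta> y = val \<beta>' y\<rbrakk> \<Longrightarrow> val \<beta> x = val \<beta>' x"
begin

fun run :: "'a \<Rightarrow> 'b \<Rightarrow> nat \<Rightarrow> nat \<Rightarrow> 's" where
  "run \<alpha> \<beta> \<tau> 0 = start \<alpha> \<tau>"
| "run \<alpha> \<beta> \<tau> (Suc t) = step (val \<beta> (key \<tau> (run \<alpha> \<beta> \<tau> t))) (run \<alpha> \<beta> \<tau> t)"

definition hit :: "'a \<Rightarrow> 'b \<Rightarrow> nat \<Rightarrow> nat set" where
  "hit \<alpha> \<beta> t = (\<lambda>\<tau>. bucket (landmarks D (L \<beta>)) (key \<tau> (run \<alpha> \<beta> \<tau> t))) ` {..<N}"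

definition records :: "'b \<Rightarrow> nat set \<Rightarrow> (nat \<times> nat) set" where
  "records \<beta> J = (\<lambda>y. (y, val \<beta> y)) ` {y \<in> L \<beta>. bucket (landmarks D (L \<beta>)) y \<in> J}"

text \<open>Landmarks are announced without values; the value at a change becomes known only when
  its bucket is opened.\<close>

definition transcript :: "'a \<Rightarrow> 'b \<Rightarrow> nat set \<times> (nat set \<times> (nat \<times> nat) set) list" where
  "transcript \<alpha> \<beta> = (landmarks D (L \<beta>), map (\<lambda>t. (hit \<alpha> \<beta> t, records \<beta> (hit \<alpha> \<beta> t))) [0..<T])"

lemma finite_L: "\<beta> \<in> Bs \<Longrightarrow> finite (L \<beta>)"
  using L_subset finite_subset by blast

text \<open>Alice's input \<open>\<alpha>\<close> with Bob's input \<open>\<beta>'\<close> runs as with \<open>\<beta>\<close>: the opened buckets reveal not only the changes that were hit but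
  also that there are no others.\<close>

lemma transcript_rectangle:
  assumes \<beta>: "\<beta> \<in> Bs" "\<beta>' \<in> Bs" and eq: "transcript \<alpha> \<beta> = transcript \<alpha>' \<beta>'"
    and "t \<le> T" "\<tau> < N"
  shows "run \<alpha> \<beta>' \<tau> t = run \<alpha> \<beta> \<tau> t"
  using \<open>t \<le> T\<close>
proof (induction t)
  case (Suc t)
  let ?P = "landmarks D (L \<beta>)" and ?x = "key \<tau> (run \<alpha> \<beta> \<tau> t)" and ?J = "hit \<alpha> \<beta> t"
  have P: "landmarks D (L \<beta>') = ?P" using eq by (simp add: transcript_def)
  have "map (\<lambda>t. (hit \<alpha> \<beta> t, records \<beta> (hit \<alpha> \<beta> t))) [0..<T] ! t
      = map (\<lambda>t. (hit \<alpha>' \<beta>' t, records \<beta>' (hit \<alpha>' \<beta>' t))) [0..<T] ! t"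
    using eq unfolding transcript_def prod.inject by metis
  then have "hit \<alpha> \<beta> t = hit \<alpha>' \<beta>' t \<and> records \<beta> ?J = records \<beta>' (hit \<alpha>' \<beta>' t)"
    using Suc.prems by simp metis
  then have R: "records \<beta> ?J = records \<beta>' ?J" by metis
  have J: "bucket ?P ?x \<in> ?J" unfolding hit_def using \<open>\<tau> < N\<close> by auto
  \<comment> \<open>Keys between the start of the bucket and the probed key lie in the same opened
    bucket.\<close>
  have rec: "(y, v) \<in> records \<beta> ?J \<longleftrightarrow> y \<in> L \<beta> \<and> v = val \<beta> y"
      "(y, v) \<in> records \<beta>' ?J \<longleftrightarrow> y \<in> L \<beta>' \<and> v = val \<beta>' y"
    if "bucket ?P ?x \<le> y" "y \<le> ?x" for y v
    using bucket_eq[OF zero_in_landmarks that] J P by (auto simp: records_def)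
  have "val \<beta> ?x = val \<beta>' ?x"
  proof (rule determined[OF \<beta>])
    show "?x < K" using key_less \<open>\<tau> < N\<close> .
    show "bucket ?P ?x \<le> ?x" by (rule bucket_in(2)[OF zero_in_landmarks])
    show "bucket ?P ?x = 0 \<or> bucket ?P ?x \<in> L \<beta> \<and> bucket ?P ?x \<in> L \<beta>'"
      using bucket_in(1)[OF zero_in_landmarks, of D "L \<beta>" ?x] landmarks_subset[of D "L \<beta>"]
        landmarks_subset[of D "L \<beta>'"] P by auto
  next
    fix y assume y: "bucket ?P ?x \<le> y" "y \<le> ?x"
    show "y \<in> L \<beta> \<longleftrightarrow> y \<in> L \<beta>'" using rec[OF y] R by auto
    show "val \<beta> y = val \<beta>' y" if "y \<in> L \<beta>" using rec[OF y] R that by auto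
  qed
  then show ?case using Suc by simp
qed simp

lemma hit_subset: "hit \<alpha> \<beta> t \<subseteq> landmarks D (L \<beta>)"
  unfolding hit_def using bucket_in(1)[OF zero_in_landmarks] by auto

lemma card_hit: "card (hit \<alpha> \<beta> t) \<le> N"
  unfolding hit_def using card_image_le[of "{..<N}"] by simp

lemma card_records:
  assumes "\<beta> \<in> Bs" "finite J" shows "card (records \<beta> J) \<le> card J * D"
proof -
  have "records \<beta> J = (\<Union>p\<in>J. (\<lambda>y. (y, val \<beta> y)) ` {y \<in> L \<beta>. bucket (landmarks D (L \<beta>)) y = p})"
    by (auto simp: records_def)
  also have "card \<dots> \<le> (\<Sum>p\<in>J. card ((\<lambda>y. (y, val \<beta> y)) ` {y \<in> L \<beta>. bucket (landmarks D (L \<beta>)) y = p}))"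
    using assms by (intro card_UN_le)
  also have "\<dots> \<le> (\<Sum>p\<in>J. D)"
    using finite_L[OF assms(1)] D_pos
    by (intro sum_mono order_trans[OF card_image_le card_bucket_le]) auto
  finally show ?thesis by simp
qed

definition transcripts :: "nat \<Rightarrow> (nat set \<times> (nat set \<times> (nat \<times> nat) set) list) set" where
  "transcripts m = {P. P \<subseteq> {..<K} \<and> card P \<le> m} \<times>
     {xs. set xs \<subseteq> {J. J \<subseteq> {..<K} \<and> card J \<le> N} \<times> {R. R \<subseteq> {..<K} \<times> {..<W} \<and> card R \<le> N * D} \<and> length xs = T}"

lemma finite_transcripts: "finite (transcripts m)"
  unfolding transcripts_def by (intro finite_cartesian_product finite_lists_length_eq) auto

lemma transcript_in:
  assumes "\<beta> \<in> Bs" "card (landmarks D (L \<beta>)) \<le> m"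
  shows "transcript \<alpha> \<beta> \<in> transcripts m"
proof -
  have P: "landmarks D (L \<beta>) \<subseteq> {..<K}"
    using landmarks_subset[of D "L \<beta>"] L_subset[OF assms(1)] K_pos by auto
  have "card (records \<beta> (hit \<alpha> \<beta> t)) \<le> N * D" for t
    using card_records[OF assms(1), of "hit \<alpha> \<beta> t"] card_hit[of \<alpha> \<beta> t]
    by (meson finite_imageI finite_lessThan hit_def mult_le_mono1 order_trans[rotated] finite_subset hit_subset finite_landmarks finite_L assms(1))
  moreover have "records \<beta> (hit \<alpha> \<beta> t) \<subseteq> {..<K} \<times> {..<W}" for t
    using L_subset[OF assms(1)] val_less[OF assms(1)] by (auto simp: records_def)
  moreover have "hit \<alpha> \<beta> t \<subseteq> {..<K}" for t using hit_subset P by blast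
  ultimately show ?thesis
    unfolding transcript_def transcripts_def using assms P card_hit
    by (auto simp: image_subset_iff simp del: lessThan_iff)
qed

text \<open>\<open>q\<close> bits name a key or a key with its value. There are at most
  \<open>m\<close> landmarks and, per round, at most \<open>N\<close> buckets and
  \<open>N * D\<close> records to name.\<close>

lemma card_transcripts:
  assumes "K * W + 1 \<le> 2 ^ q" "1 \<le> W"
  shows "real (card (transcripts m)) \<le> 2 ^ (q * (m + T * (N + N * D)))"
proof -
  have K: "K + 1 \<le> 2 ^ q" using assms by (cases W) (auto intro: order_trans[rotated])
  have "card (transcripts m) = card {P. P \<subseteq> {..<K} \<and> card P \<le> m} *
     (card {J. J \<subseteq> {..<K} \<and> card J \<le> N} * card {R. R \<subseteq> {..<K} \<times> {..<W} \<and> card R \<le> N * D}) ^ T"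
    unfolding transcripts_def by (subst card_cartesian_product, subst card_lists_length_eq)
      (auto simp: card_cartesian_product)
  also have "\<dots> \<le> (K + 1) ^ m * ((K + 1) ^ N * (K * W + 1) ^ (N * D)) ^ T"
    using card_bounded_subsets_le[of "{..<K}"] card_bounded_subsets_le[of "{..<K} \<times> {..<W}"]
    by (intro mult_le_mono power_mono) (auto simp: card_cartesian_product)
  also have "\<dots> \<le> (2 ^ q) ^ m * ((2 ^ q) ^ N * (2 ^ q) ^ (N * D)) ^ T"
    using assms K by (intro mult_le_mono power_mono) auto
  also have "\<dots> = 2 ^ (q * (m + T * (N + N * D)))"
    by (simp add: power_mult[symmetric] power_add[symmetric] algebra_simps)
  finally show ?thesis by (metis of_nat_le_iff of_nat_numeral of_nat_power)
qed

text \<open>For fixed \<beta> the landmarks are fixed and the records are a function of the hit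
  sets, so only Alice's messages count: \<open>T\<close> sets of at most \<open>N\<close>
  landmarks.\<close>

lemma card_transcripts_fixed:
  assumes \<beta>: "\<beta> \<in> Bs" and "1 \<le> r" "real (card (landmarks D (L \<beta>))) \<le> r * real N"
  shows "real (card ((\<lambda>\<alpha>. transcript \<alpha> \<beta>) ` A)) \<le> (3 * r) ^ (N * T)"
proof -
  let ?P = "landmarks D (L \<beta>)"
  let ?G = "{J. J \<subseteq> ?P \<and> card J \<le> N}"
  let ?X = "{xs. set xs \<subseteq> ?G \<and> length xs = T}"
  have finP: "finite ?P" using finite_landmarks finite_L \<beta> by blast
  have finG: "finite ?G" using finP by simp
  have finX: "finite ?X" using finG by (rule finite_lists_length_eq)
  have "(\<lambda>\<alpha>. transcript \<alpha> \<beta>) ` A \<subseteq> (\<lambda>xs. (?P, map (\<lambda>J. (J, records \<beta> J)) xs)) ` ?X"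
  proof
    fix h assume "h \<in> (\<lambda>\<alpha>. transcript \<alpha> \<beta>) ` A"
    then obtain \<alpha> where "h = transcript \<alpha> \<beta>" by blast
    then show "h \<in> (\<lambda>xs. (?P, map (\<lambda>J. (J, records \<beta> J)) xs)) ` ?X"
      using hit_subset[of \<alpha> \<beta>] card_hit[of \<alpha> \<beta>]
      by (intro image_eqI[of _ _ "map (hit \<alpha> \<beta>) [0..<T]"]) (auto simp: transcript_def)
  qed
  then have "card ((\<lambda>\<alpha>. transcript \<alpha> \<beta>) ` A) \<le> card ?X"
    using finX by (rule surj_card_le[rotated])
  also have "\<dots> = card ?G ^ T" using finG by (rule card_lists_length_eq)
  finally have "real (card ((\<lambda>\<alpha>. transcript \<alpha> \<beta>) ` A)) \<le> real (card ?G ^ T)" by (rule of_nat_mono)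
  also have "\<dots> = real (card ?G) ^ T" by simp
  also have "\<dots> \<le> ((3 * r) ^ N) ^ T"
    using card_small_subsets_le[OF finP assms(2,3)] by (intro power_mono) auto
  finally show ?thesis by (simp add: power_mult)
qed

end

section \<open>Balancing the two counts\<close>

text \<open>Bob reveals about \<open>k * T * b ^ 2 * N\<close> landmarks and
  \<open>T * N * b ^ 2\<close> opened changes; by \<open>z\<close> their bits stay below the cover
  threshold \<open>k * N * b ^ 3\<close>. Routings confined to a smaller cover have on average at
  most \<open>b ^ 3\<close> of the \<open>b ^ 4\<close> choices per vertex, so Alice's messages must
  make up for a factor of order \<open>b\<close> per vertex and layer.\<close>

lemma probe_scheme_lower_bound:
  fixes b k T q :: nat and start :: "(nat \<Rightarrow> nat \<Rightarrow> nat) \<Rightarrow> nat \<Rightarrow> 's"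
  defines "B \<equiv> b ^ 4" and "N \<equiv> b ^ 4 * (b ^ 4) ^ (k - 1)"
  assumes scheme: "probe_scheme N K W (b ^ 2) (Pow (edges k B (B ^ (k - 1)))) L val key"
    and card_L: "\<And>\<beta>. \<beta> \<subseteq> edges k B (B ^ (k - 1)) \<Longrightarrow> card (L \<beta>) \<le> k * N * B * T"
    and correct: "\<And>\<alpha> \<beta>. \<alpha> \<in> {..<k} \<rightarrow>\<^sub>E shifts B (B ^ (k - 1)) \<Longrightarrow> \<beta> \<subseteq> edges k B (B ^ (k - 1)) \<Longrightarrow>
       (\<forall>\<tau><N. out (probe_scheme.run val key step start \<alpha> \<beta> \<tau> T)) \<longleftrightarrow> used k N \<alpha> \<inter> \<beta> = {}"
    and W: "1 \<le> W" "K * W + 1 \<le> 2 ^ q" and b: "36 \<le> b" and k: "0 < k"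
    and small: "k * T * b ^ 2 + 2 \<le> b ^ 4"
    and z: "q * (k * T * b ^ 2 + 2 + T * (1 + b ^ 2)) + k + 1 \<le> k * b ^ 3"
  shows "k \<le> 10 * T"
proof -
  interpret probe_scheme N T K W "b ^ 2" "Pow (edges k B (B ^ (k - 1)))" L val key step start
    using scheme .
  define M where "M = B ^ (k - 1)"
  have N: "N = B * M" by (simp add: N_def B_def M_def)
  have N_pos: "0 < N" using b by (simp add: N_def)
  let ?A = "{..<k} \<rightarrow>\<^sub>E shifts B M" and ?V = "edges k B M"
  define m where "m = k * T * b ^ 2 * N + 2"
  have lm: "card (landmarks (b ^ 2) (L \<beta>)) \<le> m" if "\<beta> \<in> Pow ?V" for \<beta>
  proof -
    have "b ^ 2 * card (landmarks (b ^ 2) (L \<beta>)) \<le> card (L \<beta>) + 2 * b ^ 2"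
      using that b by (intro card_landmarks finite_L) (auto simp: M_def)
    also have "\<dots> \<le> k * N * B * T + 2 * b ^ 2" using card_L[of \<beta>] that by (simp add: M_def)
    also have "\<dots> = b ^ 2 * m" by (simp add: m_def B_def algebra_simps flip: power_add)
    finally show ?thesis using b by simp
  qed
  have mN: "m \<le> N * (k * T * b ^ 2 + 2)" using N_pos by (simp add: m_def algebra_simps)
  have "N * (k * T * b ^ 2 + 2) \<le> N * b ^ 4" using small by (rule mult_le_mono2)
  then have mb: "m \<le> N * b ^ 4" using mN by linarith
  have main: "real (card ?A) / 2 ^ (k * N) \<le> 2 ^ (q * (m + T * (N + N * b ^ 2))) * real (card ?A) / 2 ^ (k * N * b ^ 3)
       + (3 * real (b ^ 4)) ^ (N * T) * real (b ^ 3) ^ (k * N)"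
  proof (rule disjointness_transcript_count[where V = ?V and E = "used k N" and tr = transcript and H = "transcripts m"])
    show "finite ?A" by (intro finite_PiE finite_shifts) auto
    show "finite ?V" by (rule finite_edges)
    show "used k N \<alpha> \<subseteq> ?V" if "\<alpha> \<in> ?A" for \<alpha> using used_subset_edges[OF that] by (simp add: N)
    show "card (used k N \<alpha>) = k * N" for \<alpha> by (rule card_used)
    show "finite (transcripts m)" by (rule finite_transcripts)
    show "real (card (transcripts m)) \<le> 2 ^ (q * (m + T * (N + N * b ^ 2)))"
      using W by (intro card_transcripts)
    show "transcript \<alpha> \<beta> \<in> transcripts m" if "\<beta> \<subseteq> ?V" for \<alpha> \<beta>
      using that lm[of \<beta>] by (intro transcript_in) (auto simp: M_def)
    show "real (card ((\<lambda>\<alpha>. transcript \<alpha> \<beta>) ` ?A)) \<le> (3 * real (b ^ 4)) ^ (N * T)" if "\<beta> \<subseteq> ?V" for \<beta>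
    proof (rule card_transcripts_fixed)
      show "\<beta> \<in> Pow (edges k B (B ^ (k - 1)))" using that by (simp add: M_def)
      show "1 \<le> real (b ^ 4)" using b by simp
      have "card (landmarks (b ^ 2) (L \<beta>)) \<le> b ^ 4 * N" using lm[of \<beta>] mb that by (simp add: mult.commute)
      then show "real (card (landmarks (b ^ 2) (L \<beta>))) \<le> real (b ^ 4) * real N"
        by (metis of_nat_le_iff of_nat_mult)
    qed
    show "real (card {\<alpha> \<in> ?A. used k N \<alpha> \<subseteq> Z}) \<le> real (b ^ 3) ^ (k * N)"
      if "Z \<subseteq> ?V" "card Z \<le> k * N * b ^ 3" for Z
      unfolding N using that b finite_subset[OF that(1) finite_edges]
      by (intro card_used_within_le) (auto simp: N)
    fix \<alpha> \<beta> \<alpha>' \<beta>' assume *: "\<alpha> \<in> ?A" "\<alpha>' \<in> ?A" "\<beta> \<subseteq> ?V" "\<beta>' \<subseteq> ?V"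
      "used k N \<alpha> \<inter> \<beta> = {}" "transcript \<alpha> \<beta> = transcript \<alpha>' \<beta>'"
    then have "\<forall>\<tau><N. out (run \<alpha> \<beta> \<tau> T)" using correct[of \<alpha> \<beta>] by (simp add: M_def)
    then have "\<forall>\<tau><N. out (run \<alpha> \<beta>' \<tau> T)"
      using transcript_rectangle[of \<beta> \<beta>' \<alpha> \<alpha>' T] * by (auto simp: M_def)
    then show "used k N \<alpha> \<inter> \<beta>' = {}" using correct[of \<alpha> \<beta>'] * by (simp add: M_def)
  qed
  \<comment> \<open>The summand \<open>k * N\<close> offsets the factor \<open>2 ^ (k * N)\<close>
    on the left of \<open>main\<close>, and the 1 makes the first term on the right at most half of
    the left side.\<close>
  have "q * (m + T * (N + N * b ^ 2)) + k * N + 1 \<le> k * N * b ^ 3"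
  proof -
    have "q * (m + T * (N + N * b ^ 2)) + k * N + 1 \<le> q * (N * (k * T * b ^ 2 + 2) + T * (N + N * b ^ 2)) + k * N + N"
      using mN N_pos by (intro add_mono mult_le_mono2) auto
    also have "\<dots> = N * (q * (k * T * b ^ 2 + 2 + T * (1 + b ^ 2)) + k + 1)" by (simp add: algebra_simps)
    also have "\<dots> \<le> N * (k * b ^ 3)" using z by (rule mult_le_mono2)
    finally show ?thesis by (simp add: mult_ac)
  qed
  then have "(2::real) ^ (q * (m + T * (N + N * b ^ 2)) + k * N + 1) \<le> 2 ^ (k * N * b ^ 3)"
    by (intro power_increasing) auto
  then have "2 ^ (q * (m + T * (N + N * b ^ 2))) / 2 ^ (k * N * b ^ 3) \<le> 1 / (2 * 2 ^ (k * N) :: real)"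
    by (simp add: power_add field_simps)
  then have "real (card ?A) * (2 ^ (q * (m + T * (N + N * b ^ 2))) / 2 ^ (k * N * b ^ 3)) \<le> real (card ?A) * (1 / (2 * 2 ^ (k * N)))"
    by (intro mult_left_mono) auto
  then have "2 ^ (q * (m + T * (N + N * b ^ 2))) * real (card ?A) / 2 ^ (k * N * b ^ 3) \<le> real (card ?A) / 2 ^ (k * N) / 2"
    by (simp add: field_simps)
  with main have "real (card ?A) / 2 ^ (k * N) / 2 \<le> (3 * real (b ^ 4)) ^ (N * T) * real (b ^ 3) ^ (k * N)"
    by linarith
  then have "real (card ?A) \<le> 2 * ((3 * real (b ^ 4)) ^ (N * T) * (2 * real (b ^ 3)) ^ (k * N))"
    by (simp add: field_simps power_mult_distrib)
  moreover have "(real B / 3) ^ (k * N) \<le> real (card ?A)"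
    unfolding N using b by (intro card_shifts_family_ge) (auto simp: B_def M_def)
  ultimately have 1: "(real B / 3) ^ (k * N) \<le> 2 * ((3 * real (b ^ 4)) ^ (N * T) * (2 * real (b ^ 3)) ^ (k * N))"
    by linarith
  \<comment> \<open>Confinement saves a factor \<open>b / 6\<close>, the quotient of
    \<open>b ^ 4 / 3\<close> and \<open>2 * b ^ 3\<close>.\<close>
  have "(real b / 6) ^ (k * N) * (2 * real (b ^ 3)) ^ (k * N) = (real B / 3) ^ (k * N)"
    unfolding power_mult_distrib[symmetric] B_def by (simp add: power_def numeral_eq_Suc)
  with 1 have "(real b / 6) ^ (k * N) * (2 * real (b ^ 3)) ^ (k * N) \<le> 2 * (3 * real (b ^ 4)) ^ (N * T) * (2 * real (b ^ 3)) ^ (k * N)"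
    by (simp add: mult.assoc)
  then have 2: "(real b / 6) ^ (k * N) \<le> 2 * (3 * real (b ^ 4)) ^ (N * T)"
    by (rule mult_right_le_imp_le) (use b in auto)
  have "3 * real b ^ 4 \<le> real b * real b ^ 4" using b by (intro mult_right_mono) auto
  also have "\<dots> = real b ^ 5" by (simp flip: power_Suc)
  finally have "3 * real (b ^ 4) \<le> real b ^ 5" by simp
  then have "(3 * real (b ^ 4)) ^ (N * T) \<le> (real b ^ 5) ^ (N * T)" by (intro power_mono) auto
  with 2 have 3: "(real b / 6) ^ (k * N) \<le> 2 * real b ^ (5 * (N * T))" by (simp add: power_mult)
  \<comment> \<open>As \<open>b \<ge> 36\<close>, squaring absorbs the 6; it turns the exponent 5
    into 10.\<close>
  have "real b ^ (k * N) \<le> ((real b / 6) ^ 2) ^ (k * N)"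
  proof (intro power_mono)
    have "36 * real b \<le> real b * real b" using b by (intro mult_right_mono) auto
    then show "real b \<le> (real b / 6) ^ 2" by (simp add: power2_eq_square)
  qed auto
  also have "\<dots> = ((real b / 6) ^ (k * N)) ^ 2" by (simp add: power_mult[symmetric] mult.commute)
  also have "\<dots> \<le> (2 * real b ^ (5 * (N * T))) ^ 2" using 3 by (intro power_mono) auto
  also have "\<dots> = 4 * real b ^ (10 * (N * T))" by (simp add: power_mult_distrib power_mult[symmetric])
  also have "\<dots> < real b ^ (10 * (N * T) + 1)" using b by simp
  finally have "real b ^ (k * N) < real b ^ (10 * (N * T) + 1)" .
  then have "k * N < 10 * (N * T) + 1" by (rule power_less_imp_less_exp[rotated]) (use b in simp)
  then have "N * k \<le> 10 * (N * T)" using mult.commute[of k N] by linarith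
  also have "\<dots> = N * (10 * T)" by simp
  finally show ?thesis using N_pos by simp
qed

section \<open>Marked ancestors as longest common substrings\<close>

text \<open>Node \<open>v\<close> of level \<open>i\<close> contributes the block \<open>0 2\<^sup>k\<^sup>-\<^sup>i c p\<^sub>0 \<dots> p\<^sub>i\<close> to the first string, leaf \<open>Q\<close> the block
  \<open>2\<^sup>k c p\<^sub>0 \<dots> p\<^sub>k\<^sub>-\<^sub>1\<close> to the second, where the \<open>p\<^sub>j\<close> name the ancestors. The left padding makes all matches between a
  marked ancestor and the selected leaf equally long. The letter 0 (separator, unmarked centre) never occurs in the second
  string, and 1 occurs there only as the centre of the selected leaf.\<close>

definition node_letter :: "nat \<Rightarrow> nat \<Rightarrow> (nat \<Rightarrow> nat \<Rightarrow> bool) \<Rightarrow> nat \<Rightarrow> nat \<Rightarrow> nat \<Rightarrow> nat" where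
  "node_letter B k m i v r =
    (if r = 0 then 0 else if r \<le> k - i then 2
     else if r = k - i + 1 then (if m i v then 1 else 0) else 3 + v mod B ^ (r - (k - i + 1)))"

definition leaf_letter :: "nat \<Rightarrow> nat \<Rightarrow> nat set \<Rightarrow> nat \<Rightarrow> nat \<Rightarrow> nat" where
  "leaf_letter B k X Q r =
    (if r < k then 2 else if r = k then (if Q \<in> X then 1 else 2) else 3 + Q mod B ^ (r - k))"

definition node_string :: "nat \<Rightarrow> nat \<Rightarrow> (nat \<Rightarrow> nat \<Rightarrow> bool) \<Rightarrow> nat list" where
  "node_string B k m = map (\<lambda>p. node_letter B k m (p div (k + 3) div B ^ k) (p div (k + 3) mod B ^ k) (p mod (k + 3)))
     [0..<k * B ^ k * (k + 3)]"

definition leaf_string :: "nat \<Rightarrow> nat \<Rightarrow> nat set \<Rightarrow> nat list" where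
  "leaf_string B k X = map (\<lambda>p. leaf_letter B k X (p div (2 * k + 1)) (p mod (2 * k + 1))) [0..<B ^ k * (2 * k + 1)]"

lemma length_node_string [simp]: "length (node_string B k m) = k * B ^ k * (k + 3)"
  and length_leaf_string [simp]: "length (leaf_string B k X) = B ^ k * (2 * k + 1)"
  by (simp_all add: node_string_def leaf_string_def)

lemma block_less: "a < (x::nat) \<Longrightarrow> r < l \<Longrightarrow> a * l + r < x * l"
proof -
  assume "a < x" "r < l"
  then have "a * l + r < (a + 1) * l" by simp
  also have "\<dots> \<le> x * l" using \<open>a < x\<close> by (intro mult_right_mono) auto
  finally show ?thesis .
qed

lemma node_string_nth:
  assumes "i < k" "v < B ^ k" "r < k + 3"
  shows "(i * B ^ k + v) * (k + 3) + r < k * B ^ k * (k + 3)"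
    "node_string B k m ! ((i * B ^ k + v) * (k + 3) + r) = node_letter B k m i v r"
proof -
  show lt: "(i * B ^ k + v) * (k + 3) + r < k * B ^ k * (k + 3)"
    using assms by (intro block_less) auto
  have "((i * B ^ k + v) * (k + 3) + r) div (k + 3) = i * B ^ k + v"
    "((i * B ^ k + v) * (k + 3) + r) mod (k + 3) = r"
    using div_mult_self3[of "k + 3" "i * B ^ k + v" r] mod_mult_self3[of "i * B ^ k + v" "k + 3" r] assms(3)
    by (simp_all only: mod_less div_less)
  moreover have "(i * B ^ k + v) div B ^ k = i" "(i * B ^ k + v) mod B ^ k = v"
    using div_mult_self3[of "B ^ k" i v] assms(2) by (simp_all only: mod_mult_self3 mod_less div_less)
  ultimately show "node_string B k m ! ((i * B ^ k + v) * (k + 3) + r) = node_letter B k m i v r"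
    unfolding node_string_def using lt by simp
qed

lemma leaf_string_nth:
  assumes "Q < B ^ k" "r < 2 * k + 1"
  shows "Q * (2 * k + 1) + r < B ^ k * (2 * k + 1)"
    "leaf_string B k X ! (Q * (2 * k + 1) + r) = leaf_letter B k X Q r"
proof -
  show lt: "Q * (2 * k + 1) + r < B ^ k * (2 * k + 1)"
    using assms by (intro block_less) auto
  have "(Q * (2 * k + 1) + r) div (2 * k + 1) = Q" "(Q * (2 * k + 1) + r) mod (2 * k + 1) = r"
    using div_mult_self3[of "2 * k + 1" Q r] mod_mult_self3[of Q "2 * k + 1" r] assms(2)
    by (simp_all only: mod_less div_less)
  then show "leaf_string B k X ! (Q * (2 * k + 1) + r) = leaf_letter B k X Q r"
    unfolding leaf_string_def using lt by simp
qed

lemma node_string_cases: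
  assumes "p < k * B ^ k * (k + 3)"
  obtains i v r where "i < k" "v < B ^ k" "r < k + 3" "p = (i * B ^ k + v) * (k + 3) + r" "r = p mod (k + 3)"
proof -
  let ?g = "p div (k + 3)"
  have g: "?g < k * B ^ k" using assms by (rule less_mult_imp_div_less)
  then have "?g div B ^ k < k" by (rule less_mult_imp_div_less)
  moreover have "0 < B ^ k" using g by (metis less_zeroE mult_0_right neq0_conv)
  moreover have "p = (?g div B ^ k * B ^ k + ?g mod B ^ k) * (k + 3) + p mod (k + 3)"
    by (metis div_mult_mod_eq)
  ultimately show ?thesis by (intro that[of "?g div B ^ k" "?g mod B ^ k" "p mod (k + 3)"]) auto
qed

lemma leaf_string_cases:
  assumes "p < B ^ k * (2 * k + 1)"
  obtains Q r where "Q < B ^ k" "r < 2 * k + 1" "p = Q * (2 * k + 1) + r"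
  by (rule that[of "p div (2 * k + 1)" "p mod (2 * k + 1)"])
    (use assms in \<open>auto simp: less_mult_imp_div_less simp del: mult_Suc_right\<close>)

lemma common_sub_nth:
  assumes "common_sub s t (a, b, l)" "x < l"
  shows "a + x < length s" "b + x < length t" "s ! (a + x) = t ! (b + x)"
proof -
  have *: "a + l \<le> length s" "b + l \<le> length t" "take l (drop a s) = take l (drop b t)"
    using assms by (auto simp: common_sub_def)
  show "a + x < length s" "b + x < length t" using * assms by auto
  have "s ! (a + x) = take l (drop a s) ! x" using *(1) assms(2) by simp
  also have "\<dots> = t ! (b + x)" unfolding *(3) using *(2) assms(2) by simp
  finally show "s ! (a + x) = t ! (b + x)" .
qed

lemma leaf_string_nonzero: "p < B ^ k * (2 * k + 1) \<Longrightarrow> leaf_string B k X ! p \<noteq> 0"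
  by (simp add: leaf_string_def leaf_letter_def)

text \<open>The match starts after the separator of the node block and \<open>i\<close> letters into
  the leaf block. It consists of \<open>k - i\<close> padding letters, the centre and
  \<open>i + 1\<close> names.\<close>

lemma marked_ancestor_imp_common_sub:
  assumes "i < k" "m i (Q mod B ^ Suc i)" "Q < B ^ k" "0 < B"
  shows "common_sub (node_string B k m) (leaf_string B k {Q})
           ((i * B ^ k + Q mod B ^ Suc i) * (k + 3) + 1, Q * (2 * k + 1) + i, k + 2)"
proof -
  let ?v = "Q mod B ^ Suc i" and ?s = "node_string B k m" and ?t = "leaf_string B k {Q}"
  let ?a = "(i * B ^ k + ?v) * (k + 3) + 1" and ?b = "Q * (2 * k + 1) + i"
  have "?v \<le> Q" by simp
  then have v: "?v < B ^ k" using assms(3) by linarith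
  have la: "?a + (k + 2) \<le> length ?s" using node_string_nth(1)[OF assms(1) v, of "k + 2"] by simp
  have lb: "?b + (k + 2) \<le> length ?t" using leaf_string_nth(1)[OF assms(3), of "i + k + 1"] assms(1) by simp
  have nth: "?s ! (?a + x) = ?t ! (?b + x)" if x: "x < k + 2" for x
  proof -
    have "?s ! (?a + x) = node_letter B k m i ?v (x + 1)"
      using node_string_nth(2)[OF assms(1) v, of "x + 1" m] x by (simp add: add.assoc add.commute[of x])
    moreover have "?t ! (?b + x) = leaf_letter B k {Q} Q (i + x)"
      using leaf_string_nth(2)[OF assms(3), of "i + x" "{Q}"] x assms(1) by (simp add: add.assoc)
    moreover have "node_letter B k m i ?v (x + 1) = leaf_letter B k {Q} Q (i + x)"
    proof (cases "k - i < x")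
      case True
      then have e: "x + 1 - (k - i + 1) = i + x - k" using assms(1) by simp
      \<comment> \<open>The names are residues modulo powers up to \<open>B ^ Suc i\<close>, so
        reducing \<open>Q\<close> modulo \<open>B ^ Suc i\<close> first does not alter them.\<close>
      have "B ^ (i + x - k) dvd B ^ Suc i" using x by (intro le_imp_power_dvd) simp
      then have "?v mod B ^ (i + x - k) = Q mod B ^ (i + x - k)" by (rule mod_mod_cancel)
      moreover have "k < i + x" using True by linarith
      ultimately show ?thesis using True e by (simp add: node_letter_def leaf_letter_def)
    qed (use assms x in \<open>auto simp: node_letter_def leaf_letter_def\<close>)
    ultimately show ?thesis by simp
  qed
  have "take (k + 2) (drop ?a ?s) = take (k + 2) (drop ?b ?t)"
    using la lb nth by (intro nth_equalityI) auto
  then show ?thesis using la lb by (simp add: common_sub_def)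
qed

text \<open>A match avoids the letter 0, so its first \<open>k + 2\<close> letters are one node
  block without its separator. The centre must then be 1, which aligns it with the centre of leaf
  \<open>Q\<close>, and the last name identifies the node as an ancestor of
  \<open>Q\<close>.\<close>

lemma common_sub_imp_marked_ancestor:
  assumes cs: "common_sub (node_string B k m) (leaf_string B k {Q}) (a, b, l)" and l: "k + 2 \<le> l"
    and m: "\<And>i v. m i v \<Longrightarrow> v < B ^ Suc i"
  shows "\<exists>i<k. m i (Q mod B ^ Suc i)"
proof -
  let ?s = "node_string B k m" and ?t = "leaf_string B k {Q}"
  have nth: "a + x < k * B ^ k * (k + 3)" "b + x < B ^ k * (2 * k + 1)" "?s ! (a + x) = ?t ! (b + x)" if "x < k + 2" for x
    using common_sub_nth[OF cs, of x] l that by auto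
  have nz: "?s ! (a + x) \<noteq> 0" if "x < k + 2" for x
    using nth[OF that] leaf_string_nonzero by simp
  have nsep: "(a + x) mod (k + 3) \<noteq> 0" if "x < k + 2" for x
  proof
    assume "(a + x) mod (k + 3) = 0"
    then have "?s ! (a + x) = 0" using nth(1)[OF that] by (simp add: node_string_def node_letter_def)
    with nz[OF that] show False ..
  qed
  have "a < k * B ^ k * (k + 3)" using nth(1)[of 0] by simp
  then obtain i v r where ivr: "i < k" "v < B ^ k" "r < k + 3" "a = (i * B ^ k + v) * (k + 3) + r" "r = a mod (k + 3)"
    by (rule node_string_cases)
  have r: "r = 1"
  proof (rule ccontr)
    assume "r \<noteq> 1"
    moreover have "a mod (k + 3) \<noteq> 0" using nsep[of 0] by simp
    then have "r \<noteq> 0" unfolding ivr(5) .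
    \<comment> \<open>The separator of the next block would fall inside the match.\<close>
    ultimately have x: "k + 3 - r < k + 2" by linarith
    have "(a + (k + 3 - r)) mod (k + 3) = (r + (k + 3 - r)) mod (k + 3)"
      using mod_add_left_eq[of a "k + 3" "k + 3 - r"] unfolding ivr(5)[symmetric] by (rule sym)
    also have "r + (k + 3 - r) = k + 3" using ivr(3) by simp
    also have "(k + 3) mod (k + 3) = 0" by (rule mod_self)
    finally show False using nsep[OF x] by simp
  qed
  have s: "?s ! (a + x) = node_letter B k m i v (x + 1)" if "x < k + 2" for x
    using node_string_nth(2)[OF ivr(1,2), of "x + 1" m] that ivr(4) r by (simp add: add.assoc add.commute[of x])
  have x1: "k - i < k + 2" by simp
  have mk: "m i v" using nz[OF x1] s[OF x1] ivr(1) by (auto simp: node_letter_def split: if_splits)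
  then have one: "?t ! (b + (k - i)) = 1" using nth(3)[OF x1] s[OF x1] by (simp add: node_letter_def)
  obtain Q' r' where Q': "Q' < B ^ k" "r' < 2 * k + 1" "b + (k - i) = Q' * (2 * k + 1) + r'"
    using leaf_string_cases[OF nth(2)[OF x1]] .
  have "leaf_letter B k {Q} Q' r' = 1" using one leaf_string_nth(2)[OF Q'(1,2), of "{Q}"] Q'(3) by simp
  then have "Q' = Q" "r' = k" by (auto simp: leaf_letter_def split: if_splits)
  \<comment> \<open>Offset \<open>k + 1\<close> of the match carries the last name, that of the node
    itself.\<close>
  have bk: "b + (k + 1) = Q * (2 * k + 1) + (k + i + 1)" using Q'(3) ivr(1) unfolding \<open>Q' = Q\<close> \<open>r' = k\<close> by linarith
  have "?t ! (b + (k + 1)) = leaf_letter B k {Q} Q (k + i + 1)"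
    unfolding bk using leaf_string_nth(2)[of Q B k "k + i + 1" "{Q}"] Q'(1) \<open>Q' = Q\<close> ivr(1) by simp
  then have "node_letter B k m i v (k + 2) = leaf_letter B k {Q} Q (k + i + 1)"
    using nth(3)[of "k + 1"] s[of "k + 1"] by simp
  moreover have "node_letter B k m i v (k + 2) = 3 + v mod B ^ Suc i"
  proof -
    have "k + 2 - (k - i + 1) = Suc i" "\<not> k + 2 \<le> k - i" "k + 2 \<noteq> k - i + 1" using ivr(1) by auto
    then show ?thesis by (simp add: node_letter_def del: power_Suc add_2_eq_Suc')
  qed
  ultimately have "v mod B ^ Suc i = Q mod B ^ Suc i" by (simp add: leaf_letter_def)
  \<comment> \<open>Every level is laid out with \<open>B ^ k\<close> blocks, but on level
    \<open>i\<close> only the first \<open>B ^ Suc i\<close> can be marked.\<close>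
  then have "v = Q mod B ^ Suc i" using m[OF mk] by simp
  with mk ivr(1) show ?thesis by blast
qed

lemma lcs_marked_ancestor:
  assumes lcs: "is_lcs (node_string B k m) (leaf_string B k {Q}) (a, b, l)"
    and m: "\<And>i v. m i v \<Longrightarrow> v < B ^ Suc i" and "Q < B ^ k" "0 < B"
  shows "k + 2 \<le> l \<longleftrightarrow> (\<exists>i<k. m i (Q mod B ^ Suc i))"
proof
  assume "k + 2 \<le> l"
  then show "\<exists>i<k. m i (Q mod B ^ Suc i)"
    using common_sub_imp_marked_ancestor[OF _ _ m] lcs by (auto simp: is_lcs_def)
next
  assume "\<exists>i<k. m i (Q mod B ^ Suc i)"
  then obtain i where "i < k" "m i (Q mod B ^ Suc i)" by blast
  from marked_ancestor_imp_common_sub[of i k m Q B, OF this assms(3,4)] lcs show "k + 2 \<le> l"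
    unfolding is_lcs_def by fastforce
qed

text \<open>Marks enter only through the centre letters, so a refresh needs at most one substitution
  per changed mark.\<close>

lemma node_string_diff:
  "{p. p < k * B ^ k * (k + 3) \<and> node_string B k m ! p \<noteq> node_string B k m' ! p}
     \<subseteq> (\<lambda>(i, v). (i * B ^ k + v) * (k + 3) + (k - i + 1)) ` {(i, v). i < k \<and> v < B ^ k \<and> m i v \<noteq> m' i v}"
proof
  fix p assume "p \<in> {p. p < k * B ^ k * (k + 3) \<and> node_string B k m ! p \<noteq> node_string B k m' ! p}"
  then have p: "p < k * B ^ k * (k + 3)" "node_string B k m ! p \<noteq> node_string B k m' ! p" by auto
  obtain i v r where ivr: "i < k" "v < B ^ k" "r < k + 3" "p = (i * B ^ k + v) * (k + 3) + r"
    using node_string_cases[OF p(1)] by metis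
  have "node_letter B k m i v r \<noteq> node_letter B k m' i v r"
    using p(2) node_string_nth(2)[OF ivr(1-3)] ivr(4) by metis
  then have "r = k - i + 1" "m i v \<noteq> m' i v" by (auto simp: node_letter_def split: if_splits)
  with ivr show "p \<in> (\<lambda>(i, v). (i * B ^ k + v) * (k + 3) + (k - i + 1)) ` {(i, v). i < k \<and> v < B ^ k \<and> m i v \<noteq> m' i v}"
    by (intro image_eqI[of _ _ "(i, v)"]) auto
qed

lemma leaf_string_select:
  assumes "Q < B ^ k"
  shows "(leaf_string B k {})[Q * (2 * k + 1) + k := 1] = leaf_string B k {Q}"
proof (rule nth_equalityI)
  fix p assume "p < length ((leaf_string B k {})[Q * (2 * k + 1) + k := 1])"
  then have p: "p < B ^ k * (2 * k + 1)" by simp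
  obtain Q' r where Q': "Q' < B ^ k" "r < 2 * k + 1" "p = Q' * (2 * k + 1) + r"
    using leaf_string_cases[OF p] .
  have iff: "Q * (2 * k + 1) + k = p \<longleftrightarrow> Q' = Q \<and> r = k"
  proof
    assume *: "Q * (2 * k + 1) + k = p"
    have "p div (2 * k + 1) = Q" "p mod (2 * k + 1) = k"
      using div_mult_self3[of "2 * k + 1" Q k] mod_mult_self3[of Q "2 * k + 1" k] *[symmetric] by simp_all
    moreover have "p div (2 * k + 1) = Q'" "p mod (2 * k + 1) = r"
      using div_mult_self3[of "2 * k + 1" Q' r] mod_mult_self3[of Q' "2 * k + 1" r] Q'(2,3) by simp_all
    ultimately show "Q' = Q \<and> r = k" by simp
  qed (use Q' in simp)
  show "(leaf_string B k {})[Q * (2 * k + 1) + k := 1] ! p = leaf_string B k {Q} ! p"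
    using leaf_string_nth(2)[OF Q'(1,2)] Q'(3) p iff
    by (auto simp: nth_list_update leaf_letter_def)
qed simp

lemma good_node_string:
  assumes "k * B ^ k * (k + 3) \<le> n" "B ^ k + 3 \<le> n" "0 < B"
  shows "good_str n n (node_string B k m)"
proof -
  have "node_letter B k m i v r < n" if "v < B ^ k" for i v r
  proof -
    have "v mod B ^ j < B ^ k" for j using that by (meson le_less_trans mod_less_eq_dividend)
    then have "3 + v mod B ^ j < n" for j using assms by (metis add.commute add_less_cancel_left less_le_trans)
    then show ?thesis using assms by (auto simp: node_letter_def)
  qed
  then show ?thesis using assms by (auto simp: good_str_def node_string_def)
qed

lemma good_leaf_string:
  assumes "B ^ k * (2 * k + 1) \<le> n" "B ^ k + 3 \<le> n" "0 < B"
  shows "good_str n n (leaf_string B k X)"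
proof -
  have "leaf_letter B k X Q r < n" if "Q < B ^ k" for Q r
  proof -
    have "Q mod B ^ j < B ^ k" for j using that by (meson le_less_trans mod_less_eq_dividend)
    then have "3 + Q mod B ^ j < n" for j using assms by (metis add.commute add_less_cancel_left less_le_trans)
    then show ?thesis using assms by (auto simp: leaf_letter_def)
  qed
  then show ?thesis using assms
    by (auto simp: good_str_def leaf_string_def less_mult_imp_div_less simp del: mult_Suc_right)
qed

section \<open>The cell-probe model\<close>

lemma exec_changes:
  assumes "exec S w p m r m' t" "0 < S"
  shows "{a. m' a \<noteq> m a} \<subseteq> {..<S} \<and> card {a. m' a \<noteq> m a} \<le> t"
  using assms(1)
proof (induction rule: exec.induct)
  case (exec_Wr p m a v r m' t)
  let ?D = "{x. m' x \<noteq> (m(a mod S := v mod 2 ^ w)) x}"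
  have sub: "{x. m' x \<noteq> m x} \<subseteq> insert (a mod S) ?D" by auto
  have D: "?D \<subseteq> {..<S}" "card ?D \<le> t" using exec_Wr.IH by auto
  then have fin: "finite ?D" using finite_subset by blast
  have "card {x. m' x \<noteq> m x} \<le> card (insert (a mod S) ?D)" using sub fin by (intro card_mono) auto
  also have "\<dots> \<le> Suc t" using D(2) fin by (simp add: card_insert_if)
  finally have "card {x. m' x \<noteq> m x} \<le> Suc t" .
  moreover have "{x. m' x \<noteq> m x} \<subseteq> {..<S}"
  proof (rule order_trans[OF sub])
    show "insert (a mod S) ?D \<subseteq> {..<S}" using D(1) \<open>0 < S\<close> by (intro insert_subsetI) simp_all
  qed
  ultimately show ?case by blast
qed auto

text \<open>A query is simulated on the memory it starts from, with its own writes kept aside in a partial map; every instruction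
  counts as one probe, writes and halted programs probing the dummy address 0.\<close>

fun probe_step :: "nat \<Rightarrow> nat \<Rightarrow> nat \<Rightarrow> prog \<times> (nat \<Rightarrow> nat option) \<Rightarrow> prog \<times> (nat \<Rightarrow> nat option)" where
  "probe_step S w v (Ret a, f) = (Ret a, f)"
| "probe_step S w v (Rd a g, f) = (g (case f (a mod S) of Some u \<Rightarrow> u | None \<Rightarrow> v), f)"
| "probe_step S w v (Wr a u p, f) = (p, f(a mod S \<mapsto> u mod 2 ^ w))"

fun probe_addr :: "nat \<Rightarrow> prog \<times> (nat \<Rightarrow> nat option) \<Rightarrow> nat" where
  "probe_addr S (Rd a g, f) = a mod S"
| "probe_addr S (p, f) = 0"

lemma probe_addr_less: "0 < S \<Longrightarrow> probe_addr S s < S"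
  by (induction S s rule: probe_addr.induct) auto

text \<open>The invariant is that the true memory \<open>m'\<close> is \<open>m\<close> overridden
  by the query's own writes \<open>f\<close>, modulo \<open>2 ^ w\<close>. Halted programs idle, so
  all queries can be run for the same number \<open>T\<close> of steps.\<close>

lemma exec_probe_steps:
  assumes "exec S w p m' r m'' t"
    and "\<And>a. m' a mod 2 ^ w = (case f a of Some u \<Rightarrow> u | None \<Rightarrow> m a mod 2 ^ w)" and "t \<le> T"
  shows "\<exists>f'. ((\<lambda>s. probe_step S w (m (probe_addr S s) mod 2 ^ w) s) ^^ T) (p, f) = (Ret r, f')"
  using assms
proof (induction arbitrary: f T rule: exec.induct)
  case (exec_Ret a m')
  have "((\<lambda>s. probe_step S w (m (probe_addr S s) mod 2 ^ w) s) ^^ T) (Ret a, f) = (Ret a, f)"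
    by (induction T) auto
  then show ?case by blast
next
  case (exec_Rd g m' a r m'' t)
  obtain T' where T: "T = Suc T'" "t \<le> T'" using exec_Rd.prems(2) by (cases T) auto
  have "probe_step S w (m (probe_addr S (Rd a g, f)) mod 2 ^ w) (Rd a g, f) = (g (m' (a mod S) mod 2 ^ w), f)"
    by (simp add: exec_Rd.prems(1))
  then show ?case unfolding T(1) funpow_Suc_right o_apply
    using exec_Rd.IH[OF exec_Rd.prems(1) T(2)] by (simp only:)
next
  case (exec_Wr p m' a u r m'' t)
  obtain T' where T: "T = Suc T'" "t \<le> T'" using exec_Wr.prems(2) by (cases T) auto
  have "\<exists>f'. ((\<lambda>s. probe_step S w (m (probe_addr S s) mod 2 ^ w) s) ^^ T') (p, f(a mod S \<mapsto> u mod 2 ^ w)) = (Ret r, f')"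
    by (rule exec_Wr.IH[OF _ T(2)]) (simp add: exec_Wr.prems(1))
  then show ?case unfolding T(1) funpow_Suc_right o_apply by simp
qed

text \<open>The edge of the butterfly behind node \<open>v\<close> of level \<open>i\<close> at time \<open>\<tau>\<close>: after \<open>i\<close> steps the path from \<open>\<tau>\<close> to \<open>Q\<close> is at the
  vertex whose high digits are the \<open>i\<close> low digits of \<open>Q\<close> and whose low digits are the \<open>k - i\<close> high digits of \<open>\<tau>\<close>.\<close>

definition mark :: "nat \<Rightarrow> nat \<Rightarrow> (nat \<times> nat \<times> nat) set \<Rightarrow> nat \<Rightarrow> nat \<Rightarrow> nat \<Rightarrow> bool" where
  "mark B k \<beta> \<tau> i v \<longleftrightarrow> v < B ^ Suc i \<and>
     (i, v mod B ^ i * B ^ (k - i) + \<tau> div B ^ i, v * B ^ (k - Suc i) + \<tau> div B ^ Suc i) \<in> \<beta>"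

text \<open>Index 0 is the unmarked tree, the same for every \<beta>, so that preprocessing cannot
  depend on Bob's input; index \<open>Suc \<tau>\<close> holds the marks seen by query
  \<tau>.\<close>

definition marks_at :: "nat \<Rightarrow> nat \<Rightarrow> (nat \<times> nat \<times> nat) set \<Rightarrow> nat \<Rightarrow> nat \<Rightarrow> nat \<Rightarrow> bool" where
  "marks_at B k \<beta> t = (case t of 0 \<Rightarrow> \<lambda>_ _. False | Suc \<tau> \<Rightarrow> mark B k \<beta> \<tau>)"

text \<open>By \<open>path_mod\<close> and \<open>path_div\<close> the endpoints in
  \<open>mark\<close>, taken at an ancestor of the sink, are the path's vertices in layers
  \<open>i\<close> and \<open>i + 1\<close>.\<close>

lemma mark_path:
  assumes \<alpha>: "\<alpha> \<in> {..<k} \<rightarrow>\<^sub>E shifts B (B ^ (k - 1))" and "0 < B" "\<tau> < B ^ k" "i < k"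
  shows "mark B k \<beta> \<tau> i (path \<alpha> k \<tau> mod B ^ Suc i) \<longleftrightarrow> (i, path \<alpha> i \<tau>, \<alpha> i (path \<alpha> i \<tau>)) \<in> \<beta>"
proof -
  let ?Q = "path \<alpha> k \<tau>"
  have *: "?Q mod B ^ j * B ^ (k - j) + \<tau> div B ^ j = path \<alpha> j \<tau>" if "j \<le> k" for j
    using path_div[OF assms(1-3) that] path_mod[OF assms(1-3) that] by (metis div_mult_mod_eq)
  have "?Q mod B ^ Suc i mod B ^ i = ?Q mod B ^ i" by (intro mod_mod_cancel le_imp_power_dvd) simp
  then show ?thesis unfolding mark_def using *[of i] *[of "Suc i"] assms by simp
qed

text \<open>Since \<open>path \<alpha> i\<close> is a bijection, every used edge lies on the path of
  exactly one source. Disjointness thus becomes a conjunction of \<open>B ^ k\<close> marked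
  ancestor queries.\<close>

lemma used_disjoint_iff:
  assumes \<alpha>: "\<alpha> \<in> {..<k} \<rightarrow>\<^sub>E shifts B (B ^ (k - 1))" and "0 < B" "0 < k"
  shows "used k (B ^ k) \<alpha> \<inter> \<beta> = {} \<longleftrightarrow> (\<forall>\<tau><B ^ k. \<not> (\<exists>i<k. mark B k \<beta> \<tau> i (path \<alpha> k \<tau> mod B ^ Suc i)))"
proof -
  have N: "B * B ^ (k - 1) = B ^ k" using \<open>0 < k\<close> by (cases k) auto
  have img: "path \<alpha> i ` {..<B ^ k} = {..<B ^ k}" if "i < k" for i
    using path_bij[OF \<alpha>, of i] that N by (simp add: bij_betw_def)
  have "used k (B ^ k) \<alpha> \<inter> \<beta> = {} \<longleftrightarrow> (\<forall>i<k. \<forall>x\<in>{..<B ^ k}. (i, x, \<alpha> i x) \<notin> \<beta>)"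
    by (auto simp: used_def)
  also have "\<dots> \<longleftrightarrow> (\<forall>i<k. \<forall>x\<in>path \<alpha> i ` {..<B ^ k}. (i, x, \<alpha> i x) \<notin> \<beta>)" using img by simp
  also have "\<dots> \<longleftrightarrow> (\<forall>i<k. \<forall>\<tau><B ^ k. \<not> mark B k \<beta> \<tau> i (path \<alpha> k \<tau> mod B ^ Suc i))"
    using mark_path[OF \<alpha> \<open>0 < B\<close>] by auto
  finally show ?thesis by blast
qed

text \<open>\<open>mark\<close> depends on \<tau> only through its quotients by \<open>B ^ i\<close>
  and \<open>B ^ Suc i\<close>, which stay the same unless \<tau> reaches a multiple of
  \<open>B ^ i\<close>.\<close>

lemma marks_change:
  assumes "marks_at B k \<beta> (Suc \<tau>) i v \<noteq> marks_at B k \<beta> \<tau> i v"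
  shows "v < B ^ Suc i" "B ^ i dvd \<tau>"
proof -
  show "v < B ^ Suc i" using assms by (auto simp: marks_at_def mark_def split: nat.splits)
  show "B ^ i dvd \<tau>"
  proof (rule ccontr)
    assume nd: "\<not> B ^ i dvd \<tau>"
    then obtain \<sigma> where \<sigma>: "\<tau> = Suc \<sigma>" by (cases \<tau>) auto
    have 1: "\<tau> div B ^ i = \<sigma> div B ^ i"
      using nd unfolding \<sigma> by (simp add: div_Suc dvd_eq_mod_eq_0)
    then have 2: "\<tau> div B ^ Suc i = \<sigma> div B ^ Suc i"
      by (simp only: power_Suc2 div_mult2_eq)
    have "mark B k \<beta> \<tau> i v = mark B k \<beta> \<sigma> i v" unfolding mark_def 1 2 ..
    then show False using assms by (simp add: marks_at_def \<sigma>)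
  qed
qed

text \<open>Each change is charged to the edge that decides the new mark. This is injective: the
  edge gives \<open>\<tau> div B ^ i\<close>, and \<tau> is a multiple of
  \<open>B ^ i\<close>.\<close>

lemma sum_marks_change_le:
  assumes "0 < B" "0 < k"
  shows "(\<Sum>\<tau><B ^ k. card {(i, v). i < k \<and> v < B ^ k \<and> marks_at B k \<beta> (Suc \<tau>) i v \<noteq> marks_at B k \<beta> \<tau> i v})
     \<le> card (edges k B (B ^ (k - 1)))"
proof -
  define C where "C \<tau> = {(i, v). i < k \<and> v < B ^ k \<and> marks_at B k \<beta> (Suc \<tau>) i v \<noteq> marks_at B k \<beta> \<tau> i v}" for \<tau>
  define f where "f = (\<lambda>(\<tau>, i, v). (i, v mod B ^ i * B ^ (k - i) + \<tau> div B ^ i, v * B ^ (k - Suc i) + \<tau> div B ^ Suc i))"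
  have N: "B * B ^ (k - 1) = B ^ k" using \<open>0 < k\<close> by (cases k) auto
  have finC: "finite (C \<tau>)" for \<tau>
    by (rule finite_subset[of _ "{..<k} \<times> {..<B ^ k}"]) (auto simp: C_def)
  have td: "\<tau> div B ^ i < B ^ (k - i)" if "\<tau> < B ^ k" "i \<le> k" for \<tau> i
    using that by (intro less_mult_imp_div_less) (simp flip: power_add)
  have CD: "i < k \<and> v < B ^ Suc i \<and> B ^ i dvd \<tau>" if "(i, v) \<in> C \<tau>" for \<tau> i v
    using that marks_change[of B k \<beta> \<tau> i v] by (auto simp: C_def)
  have inj: "inj_on f (SIGMA \<tau>:{..<B ^ k}. C \<tau>)"
  proof (rule inj_onI)
    fix a a' assume a: "a \<in> (SIGMA \<tau>:{..<B ^ k}. C \<tau>)" "a' \<in> (SIGMA \<tau>:{..<B ^ k}. C \<tau>)" and eq: "f a = f a'"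
    obtain \<tau> i v \<tau>' i' v' where aa: "a = (\<tau>, i, v)" "a' = (\<tau>', i', v')" by (metis surj_pair)
    have t: "\<tau> < B ^ k" "\<tau>' < B ^ k" and c: "(i, v) \<in> C \<tau>" "(i', v') \<in> C \<tau>'" using a aa by auto
    have i': "i' = i" using eq by (simp add: f_def aa)
    have ik: "i < k" "B ^ i dvd \<tau>" "B ^ i dvd \<tau>'" using CD[OF c(1)] CD[OF c(2)] i' by auto
    have x: "v mod B ^ i * B ^ (k - i) + \<tau> div B ^ i = v' mod B ^ i * B ^ (k - i) + \<tau>' div B ^ i"
      and y: "v * B ^ (k - Suc i) + \<tau> div B ^ Suc i = v' * B ^ (k - Suc i) + \<tau>' div B ^ Suc i"
      using eq by (auto simp: f_def aa i')
    have "\<tau> div B ^ i = \<tau>' div B ^ i"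
      using arg_cong[OF x, of "\<lambda>x. x mod B ^ (k - i)"] td[OF t(1), of i] td[OF t(2), of i] ik(1) by simp
    then have "\<tau> = \<tau>'" using ik by (metis dvd_div_mult_self)
    moreover have "v = v'" using y \<open>\<tau> = \<tau>'\<close> \<open>0 < B\<close> by simp
    ultimately show "a = a'" by (simp add: aa i')
  qed
  have img: "f ` (SIGMA \<tau>:{..<B ^ k}. C \<tau>) \<subseteq> edges k B (B ^ (k - 1))"
  proof
    fix e assume "e \<in> f ` (SIGMA \<tau>:{..<B ^ k}. C \<tau>)"
    then obtain \<tau> i v where t: "\<tau> < B ^ k" and c: "(i, v) \<in> C \<tau>" and e: "e = f (\<tau>, i, v)" by auto
    have i: "i < k" and v: "v < B ^ Suc i" using CD[OF c] by auto
    let ?u = "v mod B ^ i" and ?c = "v div B ^ i"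
    have u: "?u < B ^ i" using \<open>0 < B\<close> by simp
    have cB: "?c < B" using v by (intro less_mult_imp_div_less) simp
    have p1: "B ^ i * B ^ (k - i) = B ^ k" using i by (simp flip: power_add)
    have p2: "B ^ i * B ^ (k - Suc i) = B ^ (k - 1)" using i by (simp flip: power_add)
    have p3: "B ^ (k - i) = B * B ^ (k - Suc i)" using i by (simp add: Suc_diff_Suc flip: power_Suc)
    have x: "?u * B ^ (k - i) + \<tau> div B ^ i < B ^ k"
      using block_less[OF u td[OF t, of i]] i by (simp add: p1)
    have lt: "?u * B ^ (k - Suc i) + \<tau> div B ^ Suc i < B ^ (k - 1)"
      using block_less[OF u td[OF t, of "Suc i"]] i p2 by simp
    have "v * B ^ (k - Suc i) = (?c * B ^ i + ?u) * B ^ (k - Suc i)" by (simp only: div_mult_mod_eq)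
    also have "\<dots> = ?c * B ^ (k - 1) + ?u * B ^ (k - Suc i)" unfolding p2[symmetric] by (simp only: add_mult_distrib mult.assoc)
    finally have y: "v * B ^ (k - Suc i) + \<tau> div B ^ Suc i
        = ?c * B ^ (k - 1) + (?u * B ^ (k - Suc i) + \<tau> div B ^ Suc i)" by simp
    have "v * B ^ (k - Suc i) + \<tau> div B ^ Suc i < B ^ k"
      unfolding y using block_less[OF cB lt] N by simp
    moreover have "(v * B ^ (k - Suc i) + \<tau> div B ^ Suc i) mod B ^ (k - 1) = ?u * B ^ (k - Suc i) + \<tau> div B ^ Suc i"
      unfolding y using lt by (simp only: mod_mult_self3 mod_less)
    moreover have "(?u * B ^ (k - i) + \<tau> div B ^ i) div B = ?u * B ^ (k - Suc i) + \<tau> div B ^ Suc i"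
    proof -
      have "(?u * B ^ (k - i) + \<tau> div B ^ i) div B = (B * (?u * B ^ (k - Suc i)) + \<tau> div B ^ i) div B"
        unfolding p3 by (simp add: mult_ac)
      also have "\<dots> = ?u * B ^ (k - Suc i) + \<tau> div B ^ i div B" using \<open>0 < B\<close> by (simp only: div_mult_self4)
      finally show ?thesis by (simp only: power_Suc2 div_mult2_eq)
    qed
    ultimately show "e \<in> edges k B (B ^ (k - 1))" using x i N by (simp add: e f_def edges_def)
  qed
  have "(\<Sum>\<tau><B ^ k. card (C \<tau>)) = card (SIGMA \<tau>:{..<B ^ k}. C \<tau>)" using finC by simp
  also have "\<dots> \<le> card (edges k B (B ^ (k - 1)))" using inj img finite_edges by (rule card_inj_on_le)
  finally show ?thesis by (simp add: C_def)
qed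

section \<open>From the data structure to a probe scheme\<close>

locale bounded_lcs_ds =
  fixes n S w T :: nat and init :: "nat list \<Rightarrow> nat list \<Rightarrow> mem" and upd :: "upd_op \<Rightarrow> prog"
  assumes S_pos: "0 < S" and ds: "lcs_ds n S w init upd"
    and time: "\<lbrakk>good_str n n s0; good_str n n t0; reach n S w upd (s0, t0) (init s0 t0) st m;
       valid_op n op st; exec S w (upd op) m r m' j\<rbrakk> \<Longrightarrow> j \<le> T"
begin

text \<open>The differing positions are substituted one at a time, each update changing at most
  \<open>T\<close> cells.\<close>

lemma reach_rewrite:
  assumes good: "good_str n n s0" "good_str n n t0"
    and "reach n S w upd (s0, t0) (init s0 t0) (s, t) m"
    and "length s' = length s" "\<forall>x\<in>set s'. x < n"
  shows "\<exists>m'. reach n S w upd (s0, t0) (init s0 t0) (s', t) m' \<and> {a. m' a \<noteq> m a} \<subseteq> {..<S} \<and>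
     card {a. m' a \<noteq> m a} \<le> T * card {p. p < length s \<and> s ! p \<noteq> s' ! p}"
  using assms(3,4)
proof (induction "card {p. p < length s \<and> s ! p \<noteq> s' ! p}" arbitrary: s m)
  case 0
  then have "{p. p < length s \<and> s ! p \<noteq> s' ! p} = {}" by simp
  then have "s' = s" using 0 by (intro nth_equalityI) auto
  then show ?case using 0 by (intro exI[of _ m]) auto
next
  case (Suc d)
  let ?D = "{p. p < length s \<and> s ! p \<noteq> s' ! p}"
  obtain p where p: "p < length s" "s ! p \<noteq> s' ! p"
    using Suc.hyps(2) by (metis (mono_tags, lifting) card.empty empty_Collect_eq nat.distinct(1))
  let ?op = "(True, p, s' ! p)" and ?s = "s[p := s' ! p]"
  have valid: "valid_op n ?op (s, t)" using p Suc.prems(2) assms(5) by (simp add: valid_op_def)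
  obtain r m1 j where ex: "exec S w (upd ?op) m r m1 j"
    using ds good Suc.prems(1) valid unfolding lcs_ds_def by metis
  have j: "j \<le> T" using time[OF good Suc.prems(1) valid ex] .
  have reach1: "reach n S w upd (s0, t0) (init s0 t0) (?s, t) m1"
    using reach_step[OF Suc.prems(1) valid ex] by (simp add: apply_op_def)
  have D: "{q. q < length ?s \<and> ?s ! q \<noteq> s' ! q} = ?D - {p}" using p by (auto simp: nth_list_update)
  then have cD: "d = card {q. q < length ?s \<and> ?s ! q \<noteq> s' ! q}" using Suc.hyps(2) p by simp
  obtain m2 where m2: "reach n S w upd (s0, t0) (init s0 t0) (s', t) m2" "{a. m2 a \<noteq> m1 a} \<subseteq> {..<S}"
      "card {a. m2 a \<noteq> m1 a} \<le> T * d"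
    using Suc.hyps(1)[OF cD reach1] Suc.prems(2) cD by auto
  have m1: "{a. m1 a \<noteq> m a} \<subseteq> {..<S}" "card {a. m1 a \<noteq> m a} \<le> T"
    using exec_changes[OF ex S_pos] j by auto
  have sub: "{a. m2 a \<noteq> m a} \<subseteq> {a. m2 a \<noteq> m1 a} \<union> {a. m1 a \<noteq> m a}" by auto
  have "card {a. m2 a \<noteq> m a} \<le> card ({a. m2 a \<noteq> m1 a} \<union> {a. m1 a \<noteq> m a})"
    using sub m1 m2 finite_subset[OF _ finite_lessThan[of S]] by (intro card_mono) auto
  also have "\<dots> \<le> card {a. m2 a \<noteq> m1 a} + card {a. m1 a \<noteq> m a}" by (rule card_Un_le)
  also have "\<dots> \<le> T * Suc d" using m1 m2 by simp
  finally have "card {a. m2 a \<noteq> m a} \<le> T * card ?D" using Suc.hyps(2) by simp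
  moreover have "{a. m2 a \<noteq> m a} \<subseteq> {..<S}" using sub m1 m2 by blast
  ultimately show ?case using m2(1) by blast
qed

lemma lower_bound:
  fixes b k q :: nat
  assumes b: "36 \<le> b" and k: "0 < k"
    and n: "k * (b ^ 4) ^ k * (k + 3) \<le> n" "(b ^ 4) ^ k * (2 * k + 1) \<le> n" "(b ^ 4) ^ k + 3 \<le> n"
    and q: "S * (b ^ 4) ^ k * 2 ^ w + 1 \<le> 2 ^ q"
    and small: "k * T * b ^ 2 + 2 \<le> b ^ 4"
    and z: "q * (k * T * b ^ 2 + 2 + T * (1 + b ^ 2)) + k + 1 \<le> k * b ^ 3"
  shows "k \<le> 10 * T"
proof -
  define B where "B = b ^ 4"
  define N where "N = B ^ k"
  have B: "0 < B" using b by (simp add: B_def)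
  have N_pos: "0 < N" using B by (simp add: N_def)
  have N: "N = B * B ^ (k - 1)" using k unfolding N_def by (cases k) auto
  let ?V = "edges k B (B ^ (k - 1))"
  define str where "str \<beta> t = node_string B k (marks_at B k \<beta> t)" for \<beta> t
  define s0 where "s0 = node_string B k (\<lambda>_ _. False)"
  define t0 where "t0 = leaf_string B k {}"
  let ?m0 = "init s0 t0"
  let ?reach = "reach n S w upd (s0, t0) ?m0"
  have gs: "good_str n n (node_string B k m)" for m using n B by (intro good_node_string) (simp_all add: B_def)
  have gt: "good_str n n t0" unfolding t0_def using n B by (intro good_leaf_string) (simp_all add: B_def)
  have str0: "str \<beta> 0 = s0" for \<beta> by (simp add: str_def s0_def marks_at_def)
  define C where "C \<beta> \<tau> = {(i, v). i < k \<and> v < B ^ k \<and> marks_at B k \<beta> (Suc \<tau>) i v \<noteq> marks_at B k \<beta> \<tau> i v}" for \<beta> \<tau>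
  \<comment> \<open>For each \<beta> a history of memories is chosen, actual updates leading from
    \<open>str \<beta> t\<close> to \<open>str \<beta> (Suc t)\<close>.\<close>
  have "\<exists>M. \<forall>t. (?reach (str \<beta> t, t0) (M t) \<and> (t = 0 \<longrightarrow> M t = ?m0)) \<and>
      ({a. M (Suc t) a \<noteq> M t a} \<subseteq> {..<S} \<and> card {a. M (Suc t) a \<noteq> M t a} \<le> T * card (C \<beta> t))" for \<beta>
  proof (rule dependent_nat_choice)
    show "\<exists>x. ?reach (str \<beta> 0, t0) x \<and> (0 = (0::nat) \<longrightarrow> x = ?m0)"
      by (intro exI[of _ ?m0]) (simp add: str0 reach_init)
    fix m t assume "?reach (str \<beta> t, t0) m \<and> (t = 0 \<longrightarrow> m = ?m0)"
    then have r: "?reach (str \<beta> t, t0) m" by simp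
    have "\<exists>m'. ?reach (str \<beta> (Suc t), t0) m' \<and> {a. m' a \<noteq> m a} \<subseteq> {..<S} \<and>
       card {a. m' a \<noteq> m a} \<le> T * card {p. p < length (str \<beta> t) \<and> str \<beta> t ! p \<noteq> str \<beta> (Suc t) ! p}"
      using gs[of "marks_at B k \<beta> (Suc t)"] gs[of "\<lambda>_ _. False"] gt r
      by (intro reach_rewrite) (auto simp: str_def good_str_def s0_def)
    then obtain m' where m': "?reach (str \<beta> (Suc t), t0) m'" "{a. m' a \<noteq> m a} \<subseteq> {..<S}"
       "card {a. m' a \<noteq> m a} \<le> T * card {p. p < length (str \<beta> t) \<and> str \<beta> t ! p \<noteq> str \<beta> (Suc t) ! p}"
      by blast
    note m'(3)
    also have "card {p. p < length (str \<beta> t) \<and> str \<beta> t ! p \<noteq> str \<beta> (Suc t) ! p} \<le> card (C \<beta> t)"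
    proof -
      have fin: "finite (C \<beta> t)" by (rule finite_subset[of _ "{..<k} \<times> {..<B ^ k}"]) (auto simp: C_def)
      have "{p. p < length (str \<beta> t) \<and> str \<beta> t ! p \<noteq> str \<beta> (Suc t) ! p}
          \<subseteq> (\<lambda>(i, v). (i * B ^ k + v) * (k + 3) + (k - i + 1)) ` C \<beta> t"
        using node_string_diff[of k B "marks_at B k \<beta> (Suc t)" "marks_at B k \<beta> t"]
        by (auto simp: str_def C_def)
      then show ?thesis using surj_card_le[OF fin] by blast
    qed
    finally have "card {a. m' a \<noteq> m a} \<le> T * card (C \<beta> t)" by simp
    with m' show "\<exists>m'. (?reach (str \<beta> (Suc t), t0) m' \<and> (Suc t = 0 \<longrightarrow> m' = ?m0)) \<and>
       ({a. m' a \<noteq> m a} \<subseteq> {..<S} \<and> card {a. m' a \<noteq> m a} \<le> T * card (C \<beta> t))"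
      by (intro exI[of _ m']) simp
  qed
  then have "\<exists>M. \<forall>\<beta> t. (?reach (str \<beta> t, t0) (M \<beta> t) \<and> (t = 0 \<longrightarrow> M \<beta> t = ?m0)) \<and>
      ({a. M \<beta> (Suc t) a \<noteq> M \<beta> t a} \<subseteq> {..<S} \<and> card {a. M \<beta> (Suc t) a \<noteq> M \<beta> t a} \<le> T * card (C \<beta> t))"
    by (rule choice[OF allI])
  then obtain M where M_all: "\<forall>\<beta> t. (?reach (str \<beta> t, t0) (M \<beta> t) \<and> (t = 0 \<longrightarrow> M \<beta> t = ?m0)) \<and>
      ({a. M \<beta> (Suc t) a \<noteq> M \<beta> t a} \<subseteq> {..<S} \<and> card {a. M \<beta> (Suc t) a \<noteq> M \<beta> t a} \<le> T * card (C \<beta> t))"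
    by (rule exE)
  have M: "?reach (str \<beta> t, t0) (M \<beta> t)" "M \<beta> 0 = ?m0" "{a. M \<beta> (Suc t) a \<noteq> M \<beta> t a} \<subseteq> {..<S}"
      "card {a. M \<beta> (Suc t) a \<noteq> M \<beta> t a} \<le> T * card (C \<beta> t)" for \<beta> t
    using M_all[rule_format, of \<beta> t] M_all[rule_format, of \<beta> 0] by simp_all
  \<comment> \<open>Keys are ordered by address first and time second, so the history of one cell is
    contiguous.\<close>
  define L where "L \<beta> = {x. x < S * N \<and> M \<beta> (Suc (x mod N)) (x div N) \<noteq> M \<beta> (x mod N) (x div N)}" for \<beta>
  define val where "val \<beta> x = M \<beta> (Suc (x mod N)) (x div N) mod 2 ^ w" for \<beta> x
  define key where "key \<tau> s = probe_addr S s * N + \<tau>" for \<tau> s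
  \<comment> \<open>Query \<tau> selects the leaf at which its path ends. The queries branch off the
    history and leave no trace in it.\<close>
  define start where "start \<alpha> \<tau> = (upd (False, path \<alpha> k \<tau> * (2 * k + 1) + k, 1), Map.empty :: nat \<Rightarrow> nat option)" for \<alpha> \<tau>
  \<comment> \<open>Acceptance means that the answer is too short for a marked ancestor; an
    unfinished program is rejected.\<close>
  define out where "out = (\<lambda>(p, f :: nat \<Rightarrow> nat option). case p of Ret (x, y, l) \<Rightarrow> \<not> k + 2 \<le> l | _ \<Rightarrow> False)"
  interpret probe_scheme N T "S * N" "2 ^ w" "b ^ 2" "Pow ?V" L val key "probe_step S w" start
  proof
    show "0 < b ^ 2" "0 < S * N" using b S_pos N_pos by auto
    show "key \<tau> s < S * N" if "\<tau> < N" for \<tau> s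
      unfolding key_def using that probe_addr_less[OF S_pos] by (rule block_less[rotated])
    show "L \<beta> \<subseteq> {..<S * N}" for \<beta> by (auto simp: L_def)
    show "val \<beta> y < 2 ^ w" for \<beta> y by (simp add: val_def)
    fix \<beta> \<beta>' x p
    assume p: "x < S * N" "p \<le> x" "p = 0 \<or> p \<in> L \<beta> \<and> p \<in> L \<beta>'"
      and L: "\<And>y. p \<le> y \<Longrightarrow> y \<le> x \<Longrightarrow> y \<in> L \<beta> \<longleftrightarrow> y \<in> L \<beta>'"
      and v: "\<And>y. p \<le> y \<Longrightarrow> y \<le> x \<Longrightarrow> y \<in> L \<beta> \<Longrightarrow> val \<beta> y = val \<beta>' y"
    show "val \<beta> x = val \<beta>' x"
      using p L v
    proof (induction x)
      case 0
      show ?case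
      proof (cases "0 \<in> L \<beta>")
        case False
        then have "0 \<notin> L \<beta>'" using 0 by auto
        with False 0(1) show ?thesis using M(2) N_pos by (simp add: L_def val_def)
      qed (use 0 in auto)
    next
      case (Suc x)
      show ?case
      proof (cases "Suc x \<in> L \<beta>")
        case False
        then have nL: "Suc x \<notin> L \<beta>" "Suc x \<notin> L \<beta>'" using Suc.prems(2,4) by auto
        then have eq: "val \<gamma> (Suc x) = M \<gamma> (Suc x mod N) (Suc x div N) mod 2 ^ w" if "\<gamma> = \<beta> \<or> \<gamma> = \<beta>'" for \<gamma>
          using that Suc.prems(1) by (auto simp: L_def val_def)
        \<comment> \<open>At time 0 the history of a new cell begins; without a change it holds its
          initial content, which is independent of \<beta>.\<close>
        show ?thesis
        proof (cases "Suc x mod N = 0")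
          case True
          then show ?thesis using eq M(2) by simp
        next
          case False
          then have "Suc x mod N = Suc (x mod N)" "Suc x div N = x div N"
            by (simp_all add: mod_Suc div_Suc split: if_splits)
          then have "val \<gamma> (Suc x) = val \<gamma> x" if "\<gamma> = \<beta> \<or> \<gamma> = \<beta>'" for \<gamma>
            using eq[OF that] by (simp add: val_def)
          moreover have "val \<beta> x = val \<beta>' x"
          proof (rule Suc.IH)
            \<comment> \<open>\<open>Suc x\<close> is neither 0 nor a change, so \<open>p\<close> is
              an earlier key.\<close>
            show "p \<le> x" using Suc.prems(2,3) nL by (cases "p = Suc x") auto
          qed (use Suc.prems in auto)
          ultimately show ?thesis by simp
        qed
      qed (use Suc.prems in auto)
    qed
  qed
  \<comment> \<open>At most \<open>T\<close> cells change per changed mark, and the changed marks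
    are charged to distinct edges.\<close>
  have card_L: "card (L \<beta>) \<le> k * N * B * T" for \<beta>
  proof -
    have "card (L \<beta>) \<le> card (SIGMA \<tau>:{..<N}. {a. M \<beta> (Suc \<tau>) a \<noteq> M \<beta> \<tau> a})"
    proof (rule card_inj_on_le)
      show "inj_on (\<lambda>x. (x mod N, x div N)) (L \<beta>)"
        by (rule inj_onI) (metis div_mult_mod_eq prod.inject)
      show "(\<lambda>x. (x mod N, x div N)) ` L \<beta> \<subseteq> (SIGMA \<tau>:{..<N}. {a. M \<beta> (Suc \<tau>) a \<noteq> M \<beta> \<tau> a})"
        using N_pos by (auto simp: L_def)
      show "finite (SIGMA \<tau>:{..<N}. {a. M \<beta> (Suc \<tau>) a \<noteq> M \<beta> \<tau> a})"
        using finite_subset[OF M(3) finite_lessThan] by (intro finite_SigmaI) auto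
    qed
    also have "\<dots> = (\<Sum>\<tau><N. card {a. M \<beta> (Suc \<tau>) a \<noteq> M \<beta> \<tau> a})"
      using finite_subset[OF M(3) finite_lessThan] by (intro card_SigmaI) auto
    also have "\<dots> \<le> (\<Sum>\<tau><N. T * card (C \<beta> \<tau>))" using M(4) by (intro sum_mono)
    also have "\<dots> = T * (\<Sum>\<tau><N. card (C \<beta> \<tau>))" by (simp add: sum_distrib_left)
    also have "\<dots> \<le> T * card ?V"
      using sum_marks_change_le[OF B k, of \<beta>] unfolding C_def N_def by (rule mult_le_mono2)
    also have "\<dots> \<le> T * (k * N * B)" using card_edges_le[of k B "B ^ (k - 1)"] unfolding N by (rule mult_le_mono2)
    finally show ?thesis by (simp only: mult.commute)
  qed
  have out: "out (run \<alpha> \<beta> \<tau> T) \<longleftrightarrow> \<not> (\<exists>i<k. mark B k \<beta> \<tau> i (path \<alpha> k \<tau> mod B ^ Suc i))"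
    if \<alpha>: "\<alpha> \<in> {..<k} \<rightarrow>\<^sub>E shifts B (B ^ (k - 1))" and \<tau>: "\<tau> < N" for \<alpha> \<beta> \<tau>
  proof -
    let ?Q = "path \<alpha> k \<tau>" and ?m = "M \<beta> (Suc \<tau>)"
    let ?op = "(False, ?Q * (2 * k + 1) + k, 1)"
    have Q: "?Q < B ^ k" using bij_betwE[OF path_bij[OF \<alpha>, of k]] \<tau> N N_def by auto
    have valid: "valid_op n ?op (str \<beta> (Suc \<tau>), t0)"
      using leaf_string_nth(1)[OF Q, of k] n(3) by (simp add: valid_op_def t0_def)
    obtain r m' j where ex: "exec S w (upd ?op) ?m r m' j"
        and lcs: "is_lcs (fst (apply_op ?op (str \<beta> (Suc \<tau>), t0))) (snd (apply_op ?op (str \<beta> (Suc \<tau>), t0))) r"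
      using ds gs[of "\<lambda>_ _. False"] gt M(1)[of \<beta> "Suc \<tau>"] valid unfolding lcs_ds_def s0_def by metis
    have jT: "j \<le> T" using time[OF _ gt M(1) valid ex] gs by (simp add: s0_def)
    obtain x y l where r: "r = (x, y, l)" by (cases r)
    have lcs': "is_lcs (node_string B k (mark B k \<beta> \<tau>)) (leaf_string B k {?Q}) (x, y, l)"
      using lcs leaf_string_select[OF Q] by (simp add: apply_op_def t0_def str_def marks_at_def r)
    have iff: "k + 2 \<le> l \<longleftrightarrow> (\<exists>i<k. mark B k \<beta> \<tau> i (?Q mod B ^ Suc i))"
      using lcs_marked_ancestor[OF lcs' _ Q B] by (simp add: mark_def)
    have val_key: "val \<beta> (key \<tau> s) = ?m (probe_addr S s) mod 2 ^ w" for s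
    proof -
      have "key \<tau> s mod N = \<tau>" "key \<tau> s div N = probe_addr S s"
        using \<tau> N_pos by (simp_all add: key_def)
      then show ?thesis by (simp add: val_def)
    qed
    have "run \<alpha> \<beta> \<tau> t = ((\<lambda>s. probe_step S w (?m (probe_addr S s) mod 2 ^ w) s) ^^ t) (start \<alpha> \<tau>)" for t
      by (induction t) (simp_all add: val_key)
    moreover have "\<exists>f'. ((\<lambda>s. probe_step S w (?m (probe_addr S s) mod 2 ^ w) s) ^^ T) (upd ?op, Map.empty) = (Ret r, f')"
      by (rule exec_probe_steps[OF ex _ jT]) simp
    ultimately obtain f' where "run \<alpha> \<beta> \<tau> T = (Ret r, f')" by (auto simp: start_def)
    then show ?thesis using iff by (simp add: out_def r)
  qed
  show ?thesis
  proof (rule probe_scheme_lower_bound[where b = b and start = start and out = out and L = L and val = val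
        and key = key and step = "probe_step S w" and K = "S * N" and W = "2 ^ w" and q = q])
    show "probe_scheme (b ^ 4 * (b ^ 4) ^ (k - 1)) (S * N) (2 ^ w) (b\<^sup>2) (Pow (edges k (b ^ 4) ((b ^ 4) ^ (k - 1)))) L val key"
      using probe_scheme_axioms unfolding N B_def .
    show "card (L \<beta>) \<le> k * (b ^ 4 * (b ^ 4) ^ (k - 1)) * b ^ 4 * T" for \<beta>
      using card_L unfolding N B_def .
    fix \<alpha> \<beta> assume "\<alpha> \<in> {..<k} \<rightarrow>\<^sub>E shifts (b ^ 4) ((b ^ 4) ^ (k - 1))"
    then have \<alpha>: "\<alpha> \<in> {..<k} \<rightarrow>\<^sub>E shifts B (B ^ (k - 1))" by (simp add: B_def)
    have "(\<forall>\<tau><N. out (run \<alpha> \<beta> \<tau> T)) \<longleftrightarrow> used k N \<alpha> \<inter> \<beta> = {}"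
      using out[OF \<alpha>] used_disjoint_iff[OF \<alpha> B k, of \<beta>] by (simp add: N_def)
    then show "(\<forall>\<tau><b ^ 4 * (b ^ 4) ^ (k - 1). out (run \<alpha> \<beta> \<tau> T)) \<longleftrightarrow> used k (b ^ 4 * (b ^ 4) ^ (k - 1)) \<alpha> \<inter> \<beta> = {}"
      unfolding N B_def .
  qed (use assms in \<open>simp_all add: N_def B_def\<close>)
qed

end

section \<open>The lower bound\<close>

lemma (in bounded_lcs_ds) update_time_bound:
  fixes l :: real
  defines "l \<equiv> ln (real n)"
  assumes n: "0 < n" and l10: "10 \<le> l" and ratio: "112 < l / ln l" and exp: "l * (l + 3) \<le> exp (l / 2)"
    and bits: "2 * (real S * real n * 2 ^ w) \<le> 2 powr (l\<^sup>2)" and T: "real T \<le> l"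
  shows "l / ln l / 1120 < real T"
proof -
  \<comment> \<open>The 56 is chosen so that \<open>b \<le> l ^ 7\<close> gives
    \<open>b ^ (4 * k) \<le> l ^ (28 * k) \<le> exp (l / 2)\<close>, the square root of
    \<open>n\<close>. This leaves room for the factor \<open>l * (l + 3)\<close> in the string
    lengths.\<close>
  define k where "k = nat \<lfloor>l / (56 * ln l)\<rfloor>"
  define b where "b = nat \<lceil>l ^ 6\<rceil>"
  \<comment> \<open>\<open>q\<close> has to cover the bit length of a key with its content. This is
    \<open>O(l)\<close> in the application, and \<open>l ^ 2\<close> absorbs its constant for large
    \<open>n\<close>.\<close>
  define q where "q = nat \<lceil>l\<^sup>2\<rceil>"
  have nl: "real n = exp l" using n by (simp add: l_def)
  have ln1: "1 \<le> ln l" using l10 exp_le by (subst ln_ge_iff) auto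
  have k_le: "real k \<le> l / (56 * ln l)" and k_gt: "l / (56 * ln l) - 1 < real k"
    using l10 ln1 by (auto simp: k_def)
  have "l / (56 * ln l) = l / ln l / 56" by simp
  then have k1: "1 \<le> k" using ratio k_gt by linarith
  have "l / (56 * ln l) \<le> l / 1" using l10 ln1 by (intro divide_left_mono) auto
  then have kl: "real k \<le> l" using k_le by simp
  have lp: "l ^ i \<le> l ^ j" if "i \<le> j" for i j using that l10 by (intro power_increasing) auto
  have b_ge: "l ^ 6 \<le> real b" by (simp add: b_def real_nat_ceiling_ge)
  have "real b \<le> l ^ 6 + 1" using l10 by (simp add: b_def)
  also have "\<dots> \<le> 10 * l ^ 6" using lp[of 0 6] by simp
  also have "\<dots> \<le> l * l ^ 6" using l10 by (intro mult_right_mono) auto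
  finally have b_le: "real b \<le> l ^ 7" by (simp flip: power_Suc)
  have q_ge: "l\<^sup>2 \<le> real q" by (simp add: q_def real_nat_ceiling_ge)
  have "real q \<le> l\<^sup>2 + 1" by (simp add: q_def)
  also have "\<dots> \<le> 10 * l\<^sup>2" using lp[of 0 2] by simp
  also have "\<dots> \<le> l * l\<^sup>2" using l10 by (intro mult_right_mono) auto
  finally have q_le: "real q \<le> l ^ 3" by (simp add: power2_eq_square power3_eq_cube)
  have N: "real ((b ^ 4) ^ k) \<le> exp (l / 2)"
  proof -
    have "real ((b ^ 4) ^ k) = real b ^ (4 * k)" by (simp add: power_mult)
    also have "\<dots> \<le> (l ^ 7) ^ (4 * k)" using b_le by (intro power_mono) auto
    also have "\<dots> = l ^ (28 * k)" by (simp add: power_mult[symmetric])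
    also have "\<dots> = exp (ln l) ^ (28 * k)" using l10 by simp
    also have "\<dots> = exp (real (28 * k) * ln l)" by (rule exp_of_nat_mult[symmetric])
    also have "\<dots> \<le> exp (l / 2)" using k_le ln1 by (simp add: field_simps)
    finally show ?thesis .
  qed
  have len: "x * real ((b ^ 4) ^ k) \<le> real n" if "x \<le> l * (l + 3)" for x
  proof -
    have "x * real ((b ^ 4) ^ k) \<le> exp (l / 2) * exp (l / 2)"
      using that exp N by (intro mult_mono) (auto intro: order_trans)
    then show ?thesis by (simp add: nl flip: exp_add)
  qed
  have kk: "real k * (real k + 3) \<le> l * (l + 3)" using kl l10 by (intro mult_mono) auto
  have ll: "10 * l \<le> l * (l + 3)" using l10 by (simp add: mult.commute[of 10])
  have "k \<le> 10 * T"
  proof (rule lower_bound)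
    have "36 \<le> 10 * l" using l10 by simp
    moreover have "10 * l \<le> l * l" using l10 by (intro mult_right_mono) auto
    moreover have "l * l \<le> l ^ 6" unfolding power2_eq_square[symmetric] by (rule lp) simp
    ultimately have "36 \<le> real b" using b_ge by linarith
    then show "36 \<le> b" by simp
    show "0 < k" using k1 by simp
    have "real (k * (b ^ 4) ^ k * (k + 3)) \<le> real n" using len[OF kk] by (simp add: mult_ac)
    then show "k * (b ^ 4) ^ k * (k + 3) \<le> n" unfolding of_nat_le_iff .
    have "2 * real k + 1 \<le> l * (l + 3)" using kl l10 ll by linarith
    from len[OF this] have "real ((b ^ 4) ^ k * (2 * k + 1)) \<le> real n" by (simp add: algebra_simps)
    then show "(b ^ 4) ^ k * (2 * k + 1) \<le> n" unfolding of_nat_le_iff .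
    have "1 \<le> (b ^ 4) ^ k" using \<open>36 \<le> b\<close> by simp
    moreover have "real (4 * (b ^ 4) ^ k) \<le> real n" using len[of 4] l10 ll by simp
    then have "4 * (b ^ 4) ^ k \<le> n" unfolding of_nat_le_iff .
    ultimately show "(b ^ 4) ^ k + 3 \<le> n" by linarith
    have "real ((b ^ 4) ^ k) \<le> real n" using len[of 1] l10 ll by simp
    then have "real S * real ((b ^ 4) ^ k) * 2 ^ w \<le> real S * real n * 2 ^ w"
      by (intro mult_right_mono mult_left_mono) auto
    moreover have "1 \<le> real S * real n * 2 ^ w"
      using S_pos n by (intro mult_ge1_I) (auto simp: Suc_leI)
    ultimately have "real (S * (b ^ 4) ^ k * 2 ^ w + 1) \<le> 2 * (real S * real n * 2 ^ w)" by simp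
    also have "\<dots> \<le> 2 powr (l\<^sup>2)" by (rule bits)
    also have "\<dots> \<le> 2 powr (real q)" using q_ge by simp
    also have "\<dots> = real (2 ^ q)" by (simp add: powr_realpow)
    finally show "S * (b ^ 4) ^ k * 2 ^ w + 1 \<le> 2 ^ q" unfolding of_nat_le_iff .
    have b1: "1 \<le> real b" using \<open>36 \<le> b\<close> by simp
    have kT: "real k * real T \<le> l ^ 2" unfolding power2_eq_square using kl T by (intro mult_mono) auto
    have b2: "1 \<le> real b ^ 2" using b1 by (rule one_le_power)
    have "real k * real T * real b ^ 2 + 2 \<le> l ^ 2 * real b ^ 2 + 2 * real b ^ 2"
      using kT b2 by (intro add_mono mult_right_mono) auto
    also have "\<dots> = (l ^ 2 + 2) * real b ^ 2" by (simp add: algebra_simps)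
    also have "\<dots> \<le> real b ^ 2 * real b ^ 2"
    proof (intro mult_right_mono)
      have "l ^ 2 + 2 \<le> 10 * l ^ 2" using lp[of 0 2] by simp
      also have "\<dots> \<le> l * l ^ 2" using l10 by (intro mult_right_mono) auto
      also have "\<dots> \<le> l ^ 6" using lp[of 3 6] by (simp add: power2_eq_square power3_eq_cube)
      also have "\<dots> \<le> real b" by (rule b_ge)
      also have "\<dots> \<le> real b ^ 2" using b1 by (simp add: power2_eq_square)
      finally show "l ^ 2 + 2 \<le> real b ^ 2" .
    qed simp
    also have "\<dots> = real b ^ 4" by (simp flip: power_add)
    finally have "real (k * T * b ^ 2 + 2) \<le> real (b ^ 4)" by simp
    then show "k * T * b ^ 2 + 2 \<le> b ^ 4" unfolding of_nat_le_iff .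
    \<comment> \<open>With \<open>k\<close> and \<open>T\<close> at most \<open>l\<close> and
      \<open>q \<le> l ^ 3\<close>, the left side of the last condition is at most
      \<open>(5 * l ^ 5 + 2 * l) * b ^ 2\<close>, which \<open>b \<ge> l ^ 6\<close> brings below
      \<open>b ^ 3\<close>.\<close>
    have "real k * real T * real b ^ 2 + 2 + real T * (1 + real b ^ 2)
        \<le> l ^ 2 * real b ^ 2 + 2 * real b ^ 2 + l * (2 * real b ^ 2)"
      using kT b2 T l10 by (intro add_mono mult_right_mono mult_mono) auto
    also have "\<dots> = (l ^ 2 + 2 + 2 * l) * real b ^ 2" by (simp add: algebra_simps)
    also have "\<dots> \<le> (5 * l ^ 2) * real b ^ 2"
      using lp[of 0 2] lp[of 1 2] by (intro mult_right_mono) auto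
    finally have "real q * (real k * real T * real b ^ 2 + 2 + real T * (1 + real b ^ 2)) \<le> l ^ 3 * ((5 * l ^ 2) * real b ^ 2)"
      using q_le l10 by (intro mult_mono) auto
    moreover have "real k + 1 \<le> (2 * l) * real b ^ 2"
    proof -
      have "real k + 1 \<le> (2 * l) * 1" using kl l10 by simp
      also have "\<dots> \<le> (2 * l) * real b ^ 2" using b2 l10 by (intro mult_left_mono) auto
      finally show ?thesis .
    qed
    ultimately have "real q * (real k * real T * real b ^ 2 + 2 + real T * (1 + real b ^ 2)) + real k + 1
        \<le> l ^ 3 * ((5 * l ^ 2) * real b ^ 2) + (2 * l) * real b ^ 2" by linarith
    also have "\<dots> = (5 * l ^ 5 + 2 * l) * real b ^ 2" by (simp add: algebra_simps flip: power_add)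
    also have "\<dots> \<le> real b * real b ^ 2"
    proof (intro mult_right_mono)
      have "5 * l ^ 5 + 2 * l \<le> 10 * l ^ 5" using lp[of 1 5] l10 by simp
      also have "\<dots> \<le> l * l ^ 5" using l10 by (intro mult_right_mono) auto
      also have "\<dots> = l ^ 6" by (simp flip: power_Suc)
      finally show "5 * l ^ 5 + 2 * l \<le> real b" using b_ge by linarith
    qed simp
    also have "\<dots> = 1 * real b ^ 3" by (simp flip: power_Suc)
    also have "\<dots> \<le> real k * real b ^ 3" using k1 by (intro mult_right_mono) auto
    finally have "real (q * (k * T * b ^ 2 + 2 + T * (1 + b ^ 2)) + k + 1) \<le> real (k * b ^ 3)"
      by (simp add: algebra_simps)
    then show "q * (k * T * b ^ 2 + 2 + T * (1 + b ^ 2)) + k + 1 \<le> k * b ^ 3" unfolding of_nat_le_iff .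
  qed
  then have "real k \<le> 10 * real T" by simp
  moreover define u where "u = l / ln l"
  moreover have "l / (56 * ln l) = u / 56" by (simp add: u_def)
  \<comment> \<open>By \<open>ratio\<close> the number \<open>u / 56\<close> exceeds 2, so rounding
    down loses at most half: \<open>u / 112 < k \<le> 10 * T\<close>.\<close>
  ultimately have "u / 1120 < real T" using k_gt ratio by simp
  then show ?thesis by (simp only: u_def)
qed

theorem theorem32:
  fixes S w :: "nat \<Rightarrow> nat"
    and init :: "nat \<Rightarrow> nat list \<Rightarrow> nat list \<Rightarrow> mem"
    and upd :: "nat \<Rightarrow> upd_op \<Rightarrow> prog"
    and c d :: real
  assumes poly_size: "\<forall>n\<ge>2. 1 \<le> S n \<and> real (S n) \<le> real n powr c"
    and d_pos: "d > 0"
    and word_size: "\<forall>n\<ge>2. d * log 2 (real n) \<le> real (w n) \<and> real (w n) \<le> c * log 2 (real n)"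
    and correct: "\<forall>n. lcs_ds n (S n) (w n) (init n) (upd n)"
  shows "\<exists>\<epsilon>>0. \<forall>\<^sub>F n in sequentially.
           update_time_ge n (S n) (w n) (init n) (upd n) (\<epsilon> * ln (real n) / ln (ln (real n)))"
proof (intro exI[of _ "1 / 1120"] conjI)
  have ln_lim: "filterlim (\<lambda>n. ln (real n)) at_top sequentially" by real_asymp
  \<comment> \<open>The second bound yields \<open>(2 * c + 2) * l \<le> l ^ 2 * ln 2\<close> for
    \<open>l = ln n\<close>, which the estimate \<open>bits\<close> needs.\<close>
  have e1: "\<forall>\<^sub>F n in sequentially. max 10 ((2 * c + 2) / ln 2) \<le> ln (real n)"
    using ln_lim unfolding filterlim_at_top by blast
  have e2: "\<forall>\<^sub>F n in sequentially. 112 < ln (real n) / ln (ln (real n))" by real_asymp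
  have e3: "\<forall>\<^sub>F n in sequentially. ln (real n) * (ln (real n) + 3) \<le> exp (ln (real n) / 2)" by real_asymp
  show "\<forall>\<^sub>F n in sequentially.
      update_time_ge n (S n) (w n) (init n) (upd n) (1 / 1120 * ln (real n) / ln (ln (real n)))"
    using e1 e2 e3 eventually_ge_at_top[of 2]
  proof eventually_elim
    case (elim n)
    let ?l = "ln (real n)"
    define x where "x = 1 / 1120 * ?l / ln ?l"
    \<comment> \<open>If the claimed bound fails at \<open>n\<close>, every update takes fewer than
      \<open>x\<close> probes, hence at most \<open>T\<close>.\<close>
    define T where "T = nat \<lfloor>x\<rfloor>"
    have l: "10 \<le> ?l" "(2 * c + 2) / ln 2 \<le> ?l" using elim(1) by auto
    have ln1: "1 \<le> ln ?l" using l exp_le by (subst ln_ge_iff) auto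
    have x0: "0 \<le> x" using l ln1 by (simp add: x_def)
    have Tx: "real T \<le> x" using x0 by (simp add: T_def)
    have "?l / ln ?l \<le> ?l / 1" using l ln1 by (intro divide_left_mono) auto
    moreover have "x = ?l / ln ?l / 1120" by (simp add: x_def)
    ultimately have Tl: "real T \<le> ?l" using Tx l by simp
    show ?case
    proof (rule ccontr)
      assume "\<not> ?thesis"
      then have lt: "real j < x" if "good_str n n s0" "good_str n n t0"
          "reach n (S n) (w n) (upd n) (s0, t0) (init n s0 t0) st m" "valid_op n op st"
          "exec (S n) (w n) (upd n op) m r m' j" for s0 t0 st m op r m' j
        using that unfolding update_time_ge_def x_def by (meson not_le)
      interpret bounded_lcs_ds n "S n" "w n" T "init n" "upd n"
      proof
        show "0 < S n" using poly_size elim(4) by force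
        show "lcs_ds n (S n) (w n) (init n) (upd n)" using correct by blast
        fix s0 t0 st m op r m' j
        assume "good_str n n s0" "good_str n n t0"
          "reach n (S n) (w n) (upd n) (s0, t0) (init n s0 t0) st m" "valid_op n op st"
          "exec (S n) (w n) (upd n op) m r m' j"
        then have "real j < x" by (rule lt)
        then show "j \<le> T" unfolding T_def by linarith
      qed
      have n0: "0 < real n" using elim(4) by simp
      have bits: "2 * (real (S n) * real n * 2 ^ w n) \<le> 2 powr (?l\<^sup>2)"
      proof -
        have Sn: "real (S n) \<le> exp (c * ?l)" using poly_size elim(4) n0 by (simp add: powr_def)
        have "(2::real) ^ w n = exp (real (w n) * ln 2)" by (simp add: exp_of_nat_mult)
        also have "\<dots> \<le> exp (c * ?l)"
        proof -
          have "real (w n) * ln 2 \<le> c * log 2 (real n) * ln 2"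
            using word_size elim(4) by (intro mult_right_mono) auto
          also have "\<dots> = c * ?l" by (simp add: log_def)
          finally show ?thesis by simp
        qed
        finally have wn: "(2::real) ^ w n \<le> exp (c * ?l)" .
        have "real (S n) * real n * 2 ^ w n \<le> exp (c * ?l) * exp ?l * exp (c * ?l)"
          using Sn wn n0 by (intro mult_mono) auto
        then have "2 * (real (S n) * real n * 2 ^ w n) \<le> exp (ln 2) * (exp (c * ?l) * exp ?l * exp (c * ?l))" by simp
        also have "\<dots> = exp (ln 2 + (2 * c + 1) * ?l)"
          unfolding exp_add[symmetric] by (rule arg_cong[of _ _ exp]) (simp add: algebra_simps)
        also have "\<dots> \<le> exp (?l\<^sup>2 * ln 2)"
        proof -
          \<comment> \<open>The factor 2 is absorbed by one more factor \<open>n\<close>, which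
            raises the exponent from \<open>2 * c + 1\<close> to \<open>2 * c + 2\<close>.\<close>
          have "ln 2 \<le> ?l" using l(1) ln_le_minus_one[of 2] by simp
          then have "ln 2 + (2 * c + 1) * ?l \<le> (2 * c + 2) * ?l" by (simp add: algebra_simps)
          also have "\<dots> \<le> (?l * ln 2) * ?l" using l by (intro mult_right_mono) (auto simp: field_simps)
          finally show ?thesis by (simp add: power2_eq_square mult_ac)
        qed
        finally show ?thesis by (simp add: powr_def)
      qed
      have "?l / ln ?l / 1120 < real T"
        using update_time_bound elim l bits Tl by simp
      then show False using Tx by (simp add: x_def)
    qed
  qed
qed simp

end
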